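(* Let $(Q,N,C_1,C_2,\dots)$ be a nonnegative random vector with $N\in\{0,1,2,\dots\}\cup\{\infty\}$ and $P(Q>0)>0$, and let $R$ and $R_n^*$ (the latter depending on an initial value $R_0^*$) be defined on the associated weighted branching tree as in the context. For any initial condition $R_0^* \geq 0$, if $E[Q^\beta]<\infty$, $E[(R_0^* )^\beta] < \infty$ and $\rho_\beta = E\left[ \sum_{i=1}^N C_i^\beta \right] < 1$ for some $0 < \beta \leq 1$, then $$R_n^* \Rightarrow R \qquad (n\to\infty),$$ with $E[R^\beta] < \infty$. Furthermore, under these assumptions, the distribution of $R$ is the unique solution with finite $\beta$-moment to the recursion $$R \stackrel{\mathcal{D}}{=} \sum_{i=1}^N C_i R_i + Q,$$ where $\{R_i\}$ are iid copies of $R$, independent of $(Q,N,C_1,C_2,\dots)$.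
   Context: Let $U=\bigcup_{k=0}^\infty \{1,2,3,\dots\}^k$, with $\{1,2,\dots\}^0=\{\emptyset\}$; $(\mathbf{i},j)$ denotes concatenation, $(\emptyset,j)=j$. Let $\{(Q_{\mathbf i}, N_{\mathbf i}, C_{(\mathbf i,1)}, C_{(\mathbf i,2)},\dots)\}_{\mathbf i\in U}$ be iid copies of $(Q,N,C_1,C_2,\dots)$, the copy at the root $\emptyset$ being $(Q,N,C_1,C_2,\dots)$ itself. Put $A_0=\{\emptyset\}$ and $A_n=\{(i_1,\dots,i_n)\in U: (i_1,\dots,i_{n-1})\in A_{n-1},\ 1\le i_n\le N_{(i_1,\dots,i_{n-1})}\}$ for $n\ge1$. The weights are $\Pi_\emptyset=1$ and $\Pi_{(i_1,\dots,i_n)}=C_{(i_1,\dots,i_n)}\Pi_{(i_1,\dots,i_{n-1})}$. Define $W_n=\sum_{\mathbf i\in A_n}Q_{\mathbf i}\Pi_{\mathbf i}$, $R^{(n)}=\sum_{k=0}^nW_k$, $n\ge0$, and $R=\sum_{k=0}^\infty W_k$. Let $\{R^*_{0,\mathbf i}\}_{\mathbf i\in U}$ be iid copies of the initial value $R_0^*$, independent of the entire weighted tree, and set $W_n(R_0^* )=\sum_{\mathbf i\in A_n}R^*_{0,\mathbf i}\Pi_{\mathbf i}$ and $R_n^*=R^{(n-1)}+W_n(R_0^* )$ for $n\ge1$ (so $R_n^*$ has the distribution of the $n$th iterate of the recursion started from $R_0^*$). $\Rightarrow$ denotes convergence in distribution, $\stackrel{\mathcal D}{=}$ equality in distribution.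 Solutions are understood to be distributions of nonnegative random variables. *)

theory Defs
  imports "HOL-Probability.Probability"
begin

definition tree_index :: "nat list set" where
  "tree_index = {i. \<forall>j\<in>set i. 1 \<le> j}"

definition children :: "enat \<Rightarrow> nat set" where
  "children n = {j. 1 \<le> j \<and> enat j \<le> n}"

primrec generation :: "(nat list \<Rightarrow> enat) \<Rightarrow> nat \<Rightarrow> nat list set" where
  "generation N 0 = {[]}"
| "generation N (Suc n) = {i @ [j] | i j. i \<in> generation N n \<and> j \<in> children (N i)}"

text \<open>The weight of a node is the product of the factors along its nonempty prefixes; the lemma
  \<open>weight_snoc\<close> is the usual recursion. The value of \<open>C\<close> at the root plays no role.\<close>

definition weight :: "(nat list \<Rightarrow> real) \<Rightarrow> nat list \<Rightarrow> real" where
  "weight C i = (\<Prod>k\<in>{1..length i}. C (take k i))"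

lemma weight_Nil: "weight C [] = 1"
  by (simp add: weight_def)

lemma weight_snoc: "weight C (i @ [j]) = C (i @ [j]) * weight C i"
  by (simp add: weight_def)

text \<open>\<open>(Q\<^sub>i, N\<^sub>i, C\<^bsub>(i,1)\<^esub>, C\<^bsub>(i,2)\<^esub>, \<dots>)\<close> as a random element of a product space;
  coordinates of the last component are indexed from 1.\<close>

definition branch_space :: "(real \<times> enat \<times> (nat \<Rightarrow> real)) measure" where
  "branch_space = borel \<Otimes>\<^sub>M (count_space UNIV \<Otimes>\<^sub>M (\<Pi>\<^sub>M j\<in>{1..}. borel))"

definition branch_vector ::
  "(nat list \<Rightarrow> 'a \<Rightarrow> real) \<Rightarrow> (nat list \<Rightarrow> 'a \<Rightarrow> enat) \<Rightarrow> (nat list \<Rightarrow> 'a \<Rightarrow> real) \<Rightarrow>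
    nat list \<Rightarrow> 'a \<Rightarrow> real \<times> enat \<times> (nat \<Rightarrow> real)" where
  "branch_vector Q N C i \<omega> = (Q i \<omega>, N i \<omega>, \<lambda>j\<in>{1..}. C (i @ [j]) \<omega>)"

definition iid_vars :: "'a measure \<Rightarrow> 'b measure \<Rightarrow> ('i \<Rightarrow> 'a \<Rightarrow> 'b) \<Rightarrow> 'i set \<Rightarrow> bool" where
  "iid_vars M S X I \<longleftrightarrow> prob_space.indep_vars M (\<lambda>_. S) X I \<and>
     (\<forall>i\<in>I. \<forall>j\<in>I. distr M S (X i) = distr M S (X j))"

text \<open>The generic vector \<open>(Q, N, C\<^sub>1, C\<^sub>2, \<dots>)\<close> is the copy at the root \<open>[]\<close>.\<close>

locale weighted_branching_tree = prob_space M
  for M :: "'a measure" +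
  fixes Q :: "nat list \<Rightarrow> 'a \<Rightarrow> real"
    and N :: "nat list \<Rightarrow> 'a \<Rightarrow> enat"
    and C :: "nat list \<Rightarrow> 'a \<Rightarrow> real"
  assumes iid_branch: "iid_vars M branch_space (branch_vector Q N C) tree_index"

text \<open>Independence of the initial values from the entire tree is independence of the generated
  sigma-algebras (the library's \<open>indep_var\<close> requires both variables to have the same type).\<close>

locale weighted_branching_tree_init = weighted_branching_tree M Q N C
  for M :: "'a measure" and Q N C +
  fixes R0 :: "nat list \<Rightarrow> 'a \<Rightarrow> real"
  assumes iid_init: "iid_vars M borel R0 tree_index"
    and indep_init:
      "indep_set
        (sets (vimage_algebra (space M) (\<lambda>\<omega>. \<lambda>i\<in>tree_index. R0 i \<omega>) (\<Pi>\<^sub>M i\<in>tree_index. borel)))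
        (sets (vimage_algebra (space M) (\<lambda>\<omega>. \<lambda>i\<in>tree_index. branch_vector Q N C i \<omega>)
          (\<Pi>\<^sub>M i\<in>tree_index. branch_space)))"

text \<open>Sums over the tree are taken in \<open>[0, \<infinity>]\<close>, so that they are always defined.
  \<open>tree_sum N C Q n\<close> is \<open>W\<^sub>n\<close>, and \<open>tree_sum N C R0 n\<close> is \<open>W\<^sub>n(R\<^sub>0\<^sup>*)\<close>.\<close>

definition tree_sum ::
  "(nat list \<Rightarrow> 'a \<Rightarrow> enat) \<Rightarrow> (nat list \<Rightarrow> 'a \<Rightarrow> real) \<Rightarrow> (nat list \<Rightarrow> 'a \<Rightarrow> real) \<Rightarrow>
    nat \<Rightarrow> 'a \<Rightarrow> ennreal" where
  "tree_sum N C X n \<omega> =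
     (\<Sum>\<^sub>\<infinity>i\<in>generation (\<lambda>i. N i \<omega>) n. ennreal (X i \<omega> * weight (\<lambda>i. C i \<omega>) i))"

definition tree_total ::
  "(nat list \<Rightarrow> 'a \<Rightarrow> real) \<Rightarrow> (nat list \<Rightarrow> 'a \<Rightarrow> enat) \<Rightarrow> (nat list \<Rightarrow> 'a \<Rightarrow> real) \<Rightarrow>
    'a \<Rightarrow> ennreal" where
  "tree_total Q N C \<omega> = (\<Sum>k. tree_sum N C Q k \<omega>)"

text \<open>\<open>R\<^sub>n\<^sup>* = R\<^sup>(\<^sup>n\<^sup>-\<^sup>1\<^sup>) + W\<^sub>n(R\<^sub>0\<^sup>*)\<close>; for \<open>n = 0\<close> this is the initial value at the root.\<close>

definition tree_iterate ::
  "(nat list \<Rightarrow> 'a \<Rightarrow> real) \<Rightarrow> (nat list \<Rightarrow> 'a \<Rightarrow> enat) \<Rightarrow> (nat list \<Rightarrow> 'a \<Rightarrow> real) \<Rightarrow>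
    (nat list \<Rightarrow> 'a \<Rightarrow> real) \<Rightarrow> nat \<Rightarrow> 'a \<Rightarrow> ennreal" where
  "tree_iterate Q N C R0 n \<omega> = (\<Sum>k<n. tree_sum N C Q k \<omega>) + tree_sum N C R0 n \<omega>"

text \<open>Meaningful only for almost surely finite \<open>X\<close>, as \<open>enn2real \<infinity> = 0\<close>.\<close>

definition real_law :: "'a measure \<Rightarrow> ('a \<Rightarrow> ennreal) \<Rightarrow> real measure" where
  "real_law M X = distr M borel (\<lambda>\<omega>. enn2real (X \<omega>))"

text \<open>The law on \<open>[0, \<infinity>]\<close> of \<open>Q + (\<Sum>i=1..N. C\<^sub>i R\<^sub>i)\<close>, where \<open>(Q, N, C\<^sub>1, C\<^sub>2, \<dots>)\<close> has law \<open>B\<close>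
  and the \<open>R\<^sub>i\<close> are iid with law \<open>\<mu>\<close>, independent of \<open>(Q, N, C\<^sub>1, C\<^sub>2, \<dots>)\<close>.\<close>

definition recursion_value :: "(real \<times> enat \<times> (nat \<Rightarrow> real)) \<times> (nat \<Rightarrow> real) \<Rightarrow> ennreal" where
  "recursion_value = (\<lambda>((q, n, c), r). (\<Sum>\<^sub>\<infinity>i\<in>children n. ennreal (c i * r i)) + ennreal q)"

definition recursion_law ::
  "(real \<times> enat \<times> (nat \<Rightarrow> real)) measure \<Rightarrow> real measure \<Rightarrow> ennreal measure" where
  "recursion_law B \<mu> = distr (B \<Otimes>\<^sub>M (\<Pi>\<^sub>M i\<in>{1..}. \<mu>)) borel recursion_value"

text \<open>Solutions are laws of finite nonnegative random variables; they are compared with the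
  right-hand side of the recursion as laws on \<open>[0, \<infinity>]\<close>.\<close>

definition recursion_solution ::
  "(real \<times> enat \<times> (nat \<Rightarrow> real)) measure \<Rightarrow> real measure \<Rightarrow> bool" where
  "recursion_solution B \<mu> \<longleftrightarrow>
     real_distribution \<mu> \<and> (AE x in \<mu>. 0 \<le> x) \<and> distr \<mu> borel ennreal = recursion_law B \<mu>"

end

theory Submission
  imports Defs
begin

text \<open>The proof rests on two facts: for \<open>0 < \<beta> \<le> 1\<close> the power \<open>x\<^sup>\<beta>\<close> is countably subadditive
  on \<open>[0, \<infinity>]\<close>, and the subtrees hanging off the children of the root are independent copies of
  the whole tree, independent of the root vector.

  Existence. Subadditivity gives
  \<open>R\<^sup>\<beta> \<le> \<Sum>\<^sub>n \<Sum>\<^sub>i Q\<^sub>i\<^sup>\<beta> \<Pi>\<^sub>i\<^sup>\<beta>\<close>, where \<open>i\<close> runs over generation \<open>n\<close>, and by the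
  branching property generation \<open>n\<close> contributes exactly \<open>\<rho>\<^sup>n E[Q\<^sup>\<beta>]\<close> to the expectation
  (\<open>nn_integral_weighted_sum\<close>). Since \<open>\<rho> < 1\<close>, the power \<open>R\<^sup>\<beta>\<close> has finite expectation; in
  particular \<open>R\<close> is finite almost surely. Splitting the tree at the root, the branching property
  turns the pathwise identity \<open>R = Q + \<Sum>\<^sub>j C\<^sub>j R\<^sub>j\<close> into the recursion in law
  (\<open>tree_total_solves_recursion\<close>).

  Convergence. Replacing every \<open>Q\<^sub>i\<close> by the initial value \<open>R\<^sup>*\<^sub>0\<^sub>,\<^sub>i\<close> gives again a weighted
  branching tree (\<open>tree_of_initial_values\<close>), to which the moment bound applies. So
  \<open>\<Sum>\<^sub>n W\<^sub>n(R\<^sup>*\<^sub>0)\<close> is finite almost surely, hence \<open>W\<^sub>n(R\<^sup>*\<^sub>0)\<close> tends to \<open>0\<close> and the iterates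
  converge to \<open>R\<close> almost surely, which is more than convergence in distribution.

  Uniqueness. No tree carrying the second solution is built. Given a coupling of two solutions,
  feeding independent copies of the coupled pair into the recursion, with a common root vector,
  produces another coupling of the same two laws, and its expected \<open>\<bar>x - y\<bar>\<^sup>\<beta>\<close> is at most
  \<open>\<rho>\<close> times the old one (\<open>coupling_step\<close>). Starting from the product coupling, whose cost is finite
  when both \<open>\<beta>\<close>-moments are, the cost can be made arbitrarily small, and then the two
  distribution functions agree.\<close>

section \<open>Powers with exponent at most one\<close>

text \<open>The power is real-valued exponentiation extended by \<open>\<infinity>\<close> at \<open>\<infinity>\<close>, so that finiteness of a
  power is equivalent to finiteness of the base; it is intended for exponents \<open>b > 0\<close>.\<close>

definition ennreal_powr :: "real \<Rightarrow> ennreal \<Rightarrow> ennreal" where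
  "ennreal_powr b x = (if x = \<top> then \<top> else ennreal (enn2real x powr b))"

lemma ennreal_powr_ennreal: "0 \<le> x \<Longrightarrow> ennreal_powr b (ennreal x) = ennreal (x powr b)"
  by (simp add: ennreal_powr_def)

lemma ennreal_powr_0 [simp]: "ennreal_powr b 0 = 0"
  by (simp add: ennreal_powr_def)

text \<open>The two sides differ only for negative \<open>x\<close>, where the left-hand side is \<open>0\<close>. The inequality
  therefore lets moments of possibly negative variables be bounded without sign assumptions.\<close>

lemma ennreal_powr_ennreal_le: "ennreal_powr b (ennreal x) \<le> ennreal (x powr b)"
  by (cases "0 \<le> x") (auto simp: ennreal_powr_ennreal ennreal_neg)

lemma ennreal_powr_less_top_iff: "ennreal_powr b x < \<top> \<longleftrightarrow> x < \<top>"
  by (simp add: ennreal_powr_def less_top)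

lemma ennreal_powr_mono: "0 < b \<Longrightarrow> x \<le> y \<Longrightarrow> ennreal_powr b x \<le> ennreal_powr b y"
  by (cases x; cases y) (auto simp: ennreal_powr_def top_unique intro!: ennreal_leI powr_mono2)

lemma ennreal_powr_mult:
  assumes b: "0 < b"
  shows "ennreal_powr b (x * y) = ennreal_powr b x * ennreal_powr b y"
proof -
  have zero: "ennreal_powr b z = 0 \<longleftrightarrow> z = 0" for z
    by (cases z) (auto simp: ennreal_powr_def)
  have top: "ennreal_powr b z = \<top> \<longleftrightarrow> z = \<top>" for z
    by (metis ennreal_powr_less_top_iff less_top)
  consider "x = 0 \<or> y = 0" | "x \<noteq> 0" "y \<noteq> 0" "x * y = \<top>" | "x * y \<noteq> \<top>" "x \<noteq> 0" "y \<noteq> 0"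
    by blast
  then show ?thesis
  proof cases
    case 1
    then show ?thesis by (elim disjE) simp_all
  next
    case 2
    then have "ennreal_powr b x * ennreal_powr b y = \<top>"
      using zero top by (simp add: ennreal_mult_eq_top_iff)
    then show ?thesis using 2 top by simp
  next
    case 3
    then obtain u v where "x = ennreal u" "0 \<le> u" "y = ennreal v" "0 \<le> v"
      by (cases x; cases y) (auto simp: ennreal_top_mult ennreal_mult_top)
    then show ?thesis
      by (simp add: ennreal_powr_ennreal powr_mult flip: ennreal_mult)
  qed
qed

lemma ennreal_powr_inverse: "0 < b \<Longrightarrow> ennreal_powr (1 / b) (ennreal_powr b x) = x"
  by (cases x) (auto simp: ennreal_powr_def powr_powr)

lemma powr_add_le:
  fixes x y b :: real
  assumes "0 \<le> x" "0 \<le> y" "0 < b" "b \<le> 1"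
  shows "(x + y) powr b \<le> x powr b + y powr b"
proof (cases "x + y = 0")
  case True
  then show ?thesis using assms by simp
next
  case False
  define s where "s = x + y"
  have s: "0 < s" using False assms by (simp add: s_def)
  \<comment> \<open>With \<open>s\<close> the sum, \<open>t \<le> t\<^sup>b\<close> for \<open>t = z / s \<in> [0, 1]\<close>; adding this for \<open>z = x\<close> and \<open>z = y\<close> gives the claim.\<close>
  have *: "z * s powr b \<le> s * z powr b" if "0 \<le> z" "z \<le> s" for z
  proof -
    have "(z / s) powr 1 \<le> (z / s) powr b"
      using that s assms by (intro powr_mono') auto
    then have "z / s \<le> z powr b / s powr b"
      using that s by (simp add: powr_divide)
    then show ?thesis
      using s by (simp add: field_simps)
  qed
  have "s * s powr b = x * s powr b + y * s powr b"
    by (simp add: s_def algebra_simps)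
  also have "\<dots> \<le> s * x powr b + s * y powr b"
    using assms by (intro add_mono *) (auto simp: s_def)
  finally have "s * s powr b \<le> s * (x powr b + y powr b)"
    by (simp add: algebra_simps)
  then show ?thesis using s by (simp add: s_def)
qed

lemma ennreal_powr_add_le:
  assumes "0 < b" "b \<le> 1"
  shows "ennreal_powr b (x + y) \<le> ennreal_powr b x + ennreal_powr b y"
  using assms powr_add_le[of "enn2real x" "enn2real y" b]
  by (cases x; cases y)
    (auto simp: ennreal_powr_def enn2real_plus simp flip: ennreal_plus intro!: ennreal_leI)

text \<open>The partial sums are bounded by the \<open>1 / b\<close>-th power of the right-hand side, and so is their
  supremum. Passing to the limit through the inverse power avoids a continuity argument, and infinite
  sums need no separate treatment.\<close>

lemma ennreal_powr_suminf_le: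
  fixes f :: "nat \<Rightarrow> ennreal"
  assumes b: "0 < b" "b \<le> 1"
  shows "ennreal_powr b (\<Sum>n. f n) \<le> (\<Sum>n. ennreal_powr b (f n))" (is "_ \<le> ?S")
proof -
  have fin: "ennreal_powr b (\<Sum>k<n. f k) \<le> (\<Sum>k<n. ennreal_powr b (f k))" for n
  proof (induction n)
    case (Suc n)
    then show ?case
      using ennreal_powr_add_le[OF b, of "\<Sum>k<n. f k" "f n"] by (auto intro: order_trans add_mono)
  qed simp
  have "(\<Sum>k<n. f k) \<le> ennreal_powr (1 / b) ?S" for n
  proof -
    have "ennreal_powr b (\<Sum>k<n. f k) \<le> ?S"
      using fin by (rule order_trans) (intro sum_le_suminf summableI, auto)
    then have "ennreal_powr (1 / b) (ennreal_powr b (\<Sum>k<n. f k)) \<le> ennreal_powr (1 / b) ?S"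
      using b by (intro ennreal_powr_mono) auto
    then show ?thesis using b by (simp add: ennreal_powr_inverse)
  qed
  then have "(\<Sum>n. f n) \<le> ennreal_powr (1 / b) ?S"
    by (simp add: suminf_eq_SUP SUP_least)
  then have "ennreal_powr b (\<Sum>n. f n) \<le> ennreal_powr b (ennreal_powr (1 / b) ?S)"
    using b by (intro ennreal_powr_mono)
  also have "\<dots> = ?S"
    using ennreal_powr_inverse[of "1 / b" ?S] b by simp
  finally show ?thesis .
qed

lemma borel_measurable_ennreal_powr [measurable (raw)]:
  "f \<in> borel_measurable M \<Longrightarrow> (\<lambda>x. ennreal_powr b (f x)) \<in> borel_measurable M"
  unfolding ennreal_powr_def by (intro measurable_If) auto

text \<open>Terms are differences of consecutive partial sums, and subtraction on \<open>[0, \<infinity>]\<close> is continuous away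
  from \<open>\<infinity> - \<infinity>\<close>, which finiteness of the sum rules out.\<close>

lemma ennreal_terms_tendsto_0:
  fixes f :: "nat \<Rightarrow> ennreal"
  assumes "(\<Sum>n. f n) < \<top>"
  shows "f \<longlonglongrightarrow> 0"
proof -
  have s: "(\<lambda>n. \<Sum>k<n. f k) \<longlonglongrightarrow> (\<Sum>n. f n)"
    by (rule summable_LIMSEQ) auto
  have "(\<lambda>n. (\<Sum>k<Suc n. f k) - (\<Sum>k<n. f k)) \<longlonglongrightarrow> (\<Sum>n. f n) - (\<Sum>n. f n)"
    using assms by (intro tendsto_diff_ennreal LIMSEQ_Suc s) auto
  moreover have "(\<Sum>k<n. f k) < \<top>" for n
    using assms by (rule le_less_trans[rotated]) (intro sum_le_suminf summableI, auto)
  then have "(\<Sum>k<Suc n. f k) - (\<Sum>k<n. f k) = f n" for n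
    by (simp add: ennreal_add_diff_cancel_left less_top)
  ultimately show ?thesis
    using assms by (simp add: less_top)
qed

lemma ennreal_geometric_less_top:
  fixes r :: ennreal
  assumes "r < 1"
  shows "(\<Sum>n. r ^ n) < \<top>"
proof -
  obtain x where x: "r = ennreal x" "0 \<le> x" "x < 1"
    using assms by (cases r) auto
  have "(\<Sum>n. ennreal (x ^ n)) \<noteq> \<top>"
    using x by (intro ennreal_suminf_neq_top summable_geometric) auto
  then show ?thesis using x by (simp add: ennreal_power less_top)
qed

section \<open>Sums over the children of a node\<close>

lemma infsum_nat_ennreal:
  fixes f :: "nat \<Rightarrow> ennreal"
  shows "(\<Sum>\<^sub>\<infinity>n. f n) = (\<Sum>n. f n)"
  by (rule sums_unique[OF has_sum_imp_sums[OF has_sum_infsum]])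
    (rule nonneg_summable_on_complete, simp)

text \<open>Children are numbered from \<open>1\<close>; the shift by \<open>Suc\<close> turns a sum over children into a series over
  all natural numbers, to which the convergence theorems for series apply.\<close>

lemma infsum_children:
  fixes f :: "nat \<Rightarrow> ennreal"
  shows "(\<Sum>\<^sub>\<infinity>j\<in>children n. f j) = (\<Sum>k. if enat (Suc k) \<le> n then f (Suc k) else 0)"
proof -
  have *: "children n = Suc ` {k. enat (Suc k) \<le> n}"
    by (force simp: children_def image_iff Suc_le_eq gr0_conv_Suc)
  have "(\<Sum>\<^sub>\<infinity>j\<in>children n. f j) = (\<Sum>\<^sub>\<infinity>k\<in>{k. enat (Suc k) \<le> n}. f (Suc k))"
    unfolding * by (subst infsum_reindex) (auto simp: o_def)
  also have "\<dots> = (\<Sum>\<^sub>\<infinity>k. if enat (Suc k) \<le> n then f (Suc k) else 0)"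
    by (rule infsum_cong_neutral) auto
  finally show ?thesis by (simp add: infsum_nat_ennreal)
qed

text \<open>Sums in \<open>[0, \<infinity>]\<close> are suprema over finite subsets, so by monotonicity it suffices to treat finitely
  many rows, where the identity is additivity over disjoint unions.\<close>

lemma infsum_Sigma_ennreal:
  fixes f :: "'i \<Rightarrow> 'j \<Rightarrow> ennreal"
  shows "(\<Sum>\<^sub>\<infinity>(x, y)\<in>Sigma A B. f x y) = (\<Sum>\<^sub>\<infinity>x\<in>A. \<Sum>\<^sub>\<infinity>y\<in>B x. f x y)"
proof -
  have summable: "g summable_on I" for g :: "'b \<Rightarrow> ennreal" and I
    by (rule nonneg_summable_on_complete) simp
  have finite_le: "sum g F \<le> infsum g I" if "finite F" "F \<subseteq> I" for g :: "'b \<Rightarrow> ennreal" and F I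
    using that infsum_mono_neutral[OF summable summable, of F I g g] by auto
  have finite_case: "(\<Sum>x\<in>X. \<Sum>\<^sub>\<infinity>y\<in>B x. f x y) = (\<Sum>\<^sub>\<infinity>(x, y)\<in>Sigma X B. f x y)" if "finite X" for X
    using that
  proof induction
    case (insert x X)
    have "(\<Sum>\<^sub>\<infinity>(x, y)\<in>Sigma (insert x X) B. f x y)
        = (\<Sum>\<^sub>\<infinity>(x, y)\<in>Pair x ` B x \<union> Sigma X B. f x y)"
      by (rule arg_cong[where f = "infsum _"]) auto
    also have "\<dots> = (\<Sum>\<^sub>\<infinity>(x, y)\<in>Pair x ` B x. f x y) + (\<Sum>\<^sub>\<infinity>(x, y)\<in>Sigma X B. f x y)"
      using insert.hyps by (intro infsum_Un_disjoint summable) auto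
    also have "(\<Sum>\<^sub>\<infinity>(x, y)\<in>Pair x ` B x. f x y) = (\<Sum>\<^sub>\<infinity>y\<in>B x. f x y)"
      by (subst infsum_reindex) (auto simp: inj_on_def o_def)
    finally show ?case using insert by simp
  qed simp
  show ?thesis
  proof (rule antisym)
    show "(\<Sum>\<^sub>\<infinity>(x, y)\<in>Sigma A B. f x y) \<le> (\<Sum>\<^sub>\<infinity>x\<in>A. \<Sum>\<^sub>\<infinity>y\<in>B x. f x y)"
    proof (rule infsum_le_finite_sums[OF summable])
      fix F assume F: "finite F" "F \<subseteq> Sigma A B"
      have "(\<Sum>(x, y)\<in>F. f x y) \<le> (\<Sum>\<^sub>\<infinity>(x, y)\<in>Sigma (fst ` F) B. f x y)"
        using F by (intro finite_le) force+
      also have "\<dots> = (\<Sum>x\<in>fst ` F. \<Sum>\<^sub>\<infinity>y\<in>B x. f x y)"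
        using F by (simp add: finite_case)
      also have "\<dots> \<le> (\<Sum>\<^sub>\<infinity>x\<in>A. \<Sum>\<^sub>\<infinity>y\<in>B x. f x y)"
        using F by (intro finite_le) auto
      finally show "(\<Sum>(x, y)\<in>F. f x y) \<le> (\<Sum>\<^sub>\<infinity>x\<in>A. \<Sum>\<^sub>\<infinity>y\<in>B x. f x y)" .
    qed
    show "(\<Sum>\<^sub>\<infinity>x\<in>A. \<Sum>\<^sub>\<infinity>y\<in>B x. f x y) \<le> (\<Sum>\<^sub>\<infinity>(x, y)\<in>Sigma A B. f x y)"
    proof (rule infsum_le_finite_sums[OF summable])
      fix X assume X: "finite X" "X \<subseteq> A"
      show "(\<Sum>x\<in>X. \<Sum>\<^sub>\<infinity>y\<in>B x. f x y) \<le> (\<Sum>\<^sub>\<infinity>(x, y)\<in>Sigma A B. f x y)"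
        unfolding finite_case[OF X(1)] using X
        by (intro infsum_mono_neutral summable) auto
    qed
  qed
qed

text \<open>The supremum over finite partial sums is used because multiplication on \<open>[0, \<infinity>]\<close> is not
  continuous at \<open>0 * \<infinity>\<close>.\<close>

lemma infsum_cmult_ennreal:
  fixes f :: "'i \<Rightarrow> ennreal"
  shows "(\<Sum>\<^sub>\<infinity>i\<in>A. c * f i) = c * (\<Sum>\<^sub>\<infinity>i\<in>A. f i)"
proof -
  have "(\<Sum>\<^sub>\<infinity>i\<in>A. c * f i) = (SUP F\<in>{F. finite F \<and> F \<subseteq> A}. c * sum f F)"
    by (simp add: nonneg_infsum_complete sum_distrib_left)
  also have "\<dots> = c * (SUP F\<in>{F. finite F \<and> F \<subseteq> A}. sum f F)"
    by (rule SUP_mult_left_ennreal[symmetric])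
  finally show ?thesis by (simp add: nonneg_infsum_complete)
qed

lemma borel_measurable_infsum_list:
  fixes f :: "nat list \<Rightarrow> 'a \<Rightarrow> ennreal"
  assumes [measurable]: "\<And>i. f i \<in> borel_measurable M"
  shows "(\<lambda>x. \<Sum>\<^sub>\<infinity>i. f i x) \<in> borel_measurable M"
proof -
  have b: "bij_betw (from_nat_into (UNIV :: nat list set)) UNIV UNIV"
    by (rule bij_betw_from_nat_into) (auto simp: infinite_UNIV_listI)
  have "(\<Sum>\<^sub>\<infinity>i. f i x) = (\<Sum>n. f (from_nat_into UNIV n) x)" for x
    by (subst infsum_reindex_bij_betw[OF b, symmetric]) (rule infsum_nat_ennreal)
  then show ?thesis by simp
qed

lemma suminf_infsum_ennreal:
  fixes f :: "nat \<Rightarrow> 'i \<Rightarrow> ennreal"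
  shows "(\<Sum>n. \<Sum>\<^sub>\<infinity>i\<in>A. f n i) = (\<Sum>\<^sub>\<infinity>i\<in>A. \<Sum>n. f n i)"
proof -
  have "(\<Sum>n. \<Sum>\<^sub>\<infinity>i\<in>A. f n i) = (\<Sum>\<^sub>\<infinity>(n, i)\<in>UNIV \<times> A. f n i)"
    by (simp add: infsum_Sigma_ennreal infsum_nat_ennreal)
  also have "\<dots> = (\<Sum>\<^sub>\<infinity>(n, i)\<in>prod.swap ` (A \<times> UNIV). f n i)"
    by (rule arg_cong[where f = "infsum _"]) force
  also have "\<dots> = (\<Sum>\<^sub>\<infinity>(i, n)\<in>A \<times> UNIV. f n i)"
    by (subst infsum_reindex) (auto intro!: infsum_cong)
  also have "\<dots> = (\<Sum>\<^sub>\<infinity>i\<in>A. \<Sum>n. f n i)"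
    by (simp add: infsum_Sigma_ennreal infsum_nat_ennreal)
  finally show ?thesis .
qed

lemma ennreal_powr_infsum_children_le:
  assumes "0 < b" "b \<le> 1"
  shows "ennreal_powr b (\<Sum>\<^sub>\<infinity>j\<in>children n. f j) \<le> (\<Sum>\<^sub>\<infinity>j\<in>children n. ennreal_powr b (f j))"
proof -
  have "(\<Sum>k. ennreal_powr b (if enat (Suc k) \<le> n then f (Suc k) else 0))
      = (\<Sum>k. if enat (Suc k) \<le> n then ennreal_powr b (f (Suc k)) else 0)"
    by (rule suminf_cong) simp
  then show ?thesis
    using ennreal_powr_suminf_le[OF assms, of "\<lambda>k. if enat (Suc k) \<le> n then f (Suc k) else 0"]
    by (simp add: infsum_children)
qed

lemma infsum_children_mono:
  fixes f g :: "nat \<Rightarrow> ennreal"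
  assumes "\<And>j. 1 \<le> j \<Longrightarrow> f j \<le> g j"
  shows "(\<Sum>\<^sub>\<infinity>j\<in>children n. f j) \<le> (\<Sum>\<^sub>\<infinity>j\<in>children n. g j)"
  unfolding infsum_children by (intro suminf_le summableI) (auto intro: assms)

section \<open>Tree sums as recursive functionals of the marks\<close>

type_synonym mark = "real \<times> enat \<times> (nat \<Rightarrow> real)"

text \<open>The configuration seen from the child \<open>j\<close> of the root; restricting to \<open>tree_index\<close> makes it a point of
  the product space again.\<close>

definition subtree :: "nat \<Rightarrow> (nat list \<Rightarrow> mark) \<Rightarrow> nat list \<Rightarrow> mark" where
  "subtree j v = (\<lambda>i\<in>tree_index. v (j # i))"

text \<open>Sum over generation \<open>n\<close> of the values \<open>g\<close> of the marks times the product of the transformed factors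
  \<open>h C\<close>, computed by splitting at the root. The parameters cover both \<open>W\<^sub>n\<close> (with \<open>h\<close> and \<open>g\<close> the
  embeddings into \<open>[0, \<infinity>]\<close>) and its \<open>\<beta>\<close>-analogue, in which all factors are raised to the power
  \<open>\<beta>\<close>.\<close>

primrec weighted_sum ::
  "(real \<Rightarrow> ennreal) \<Rightarrow> (mark \<Rightarrow> ennreal) \<Rightarrow> nat \<Rightarrow> (nat list \<Rightarrow> mark) \<Rightarrow> ennreal" where
  "weighted_sum h g 0 v = g (v [])"
| "weighted_sum h g (Suc n) v =
    (\<Sum>\<^sub>\<infinity>j\<in>children (fst (snd (v []))). h (snd (snd (v [])) j) * weighted_sum h g n (subtree j v))"

lemma children_ge_1: "j \<in> children n \<Longrightarrow> 1 \<le> j"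
  by (simp add: children_def)

lemma Nil_in_tree_index [simp]: "[] \<in> tree_index"
  by (simp add: tree_index_def)

lemma Cons_in_tree_index [simp]: "j # i \<in> tree_index \<longleftrightarrow> 1 \<le> j \<and> i \<in> tree_index"
  by (auto simp: tree_index_def)

lemma snoc_in_tree_index [simp]: "i @ [j] \<in> tree_index \<longleftrightarrow> i \<in> tree_index \<and> 1 \<le> j"
  by (auto simp: tree_index_def)

lemma generation_subset_tree_index: "generation N n \<subseteq> tree_index"
  by (induction n) (auto simp: children_def)

text \<open>Generations are defined by growing the tree at the leaves. The branching property splits the tree at
  the root, which needs this dual recursion.\<close>

lemma generation_Suc_Cons:
  "generation N (Suc n) = (\<Union>j\<in>children (N []). (#) j ` generation (\<lambda>i. N (j # i)) n)"
proof (induction n)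
  case 0
  show ?case by auto
next
  case (Suc n)
  have "generation N (Suc (Suc n))
      = {i @ [k] | i k. i \<in> generation N (Suc n) \<and> k \<in> children (N i)}"
    by (rule generation.simps)
  also have "\<dots> = (\<Union>j\<in>children (N []). (#) j ` generation (\<lambda>i. N (j # i)) (Suc n))"
    unfolding Suc.IH by (auto simp: image_iff)
  finally show ?case .
qed

lemma weight_Cons: "weight C (j # i) = C [j] * weight (\<lambda>i. C (j # i)) i"
proof (induction i rule: rev_induct)
  case Nil
  show ?case using weight_snoc[of C "[]" j] by (simp add: weight_Nil)
next
  case (snoc k i)
  then show ?case
    using weight_snoc[of C "j # i" k] by (simp add: weight_snoc)
qed

text \<open>Nonnegative factors are needed because \<open>ennreal\<close> truncates negative numbers: a product of two negative
  factors would count in \<open>tree_sum\<close> but not in \<open>weighted_sum\<close>.\<close>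

lemma tree_sum_eq_weighted_sum:
  assumes "\<And>i j. i \<in> tree_index \<Longrightarrow> 1 \<le> j \<Longrightarrow> 0 \<le> C (i @ [j]) \<omega>"
  shows "tree_sum N C X n \<omega> =
    weighted_sum ennreal (\<lambda>b. ennreal (fst b)) n (\<lambda>i\<in>tree_index. branch_vector X N C i \<omega>)"
  using assms
proof (induction n arbitrary: N C X)
  case 0
  show ?case by (simp add: tree_sum_def weight_Nil branch_vector_def)
next
  case (Suc n)
  let ?v = "\<lambda>i\<in>tree_index. branch_vector X N C i \<omega>"
  define gen where "gen j = generation (\<lambda>i. N (j # i) \<omega>) n" for j
  define summand where "summand i = ennreal (X i \<omega> * weight (\<lambda>i. C i \<omega>) i)" for i
  have step: "(\<Sum>\<^sub>\<infinity>i\<in>gen j. summand (j # i))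
      = ennreal (snd (snd (?v [])) j) * weighted_sum ennreal (\<lambda>b. ennreal (fst b)) n (subtree j ?v)"
    if "j \<in> children (N [] \<omega>)" for j
  proof -
    have j: "1 \<le> j" using that by (rule children_ge_1)
    have C0: "0 \<le> C [j] \<omega>" using Suc.prems[of "[]" j] j by simp
    have "(\<Sum>\<^sub>\<infinity>i\<in>gen j. summand (j # i))
        = (\<Sum>\<^sub>\<infinity>i\<in>gen j. ennreal (C [j] \<omega>) *
            ennreal (X (j # i) \<omega> * weight (\<lambda>i. C (j # i) \<omega>) i))"
      using C0 by (simp add: summand_def weight_Cons mult.left_commute flip: ennreal_mult')
    also have "\<dots> = ennreal (C [j] \<omega>) *
        tree_sum (\<lambda>i. N (j # i)) (\<lambda>i. C (j # i)) (\<lambda>i. X (j # i)) n \<omega>"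
      by (simp add: infsum_cmult_ennreal tree_sum_def gen_def)
    also have "tree_sum (\<lambda>i. N (j # i)) (\<lambda>i. C (j # i)) (\<lambda>i. X (j # i)) n \<omega>
        = weighted_sum ennreal (\<lambda>b. ennreal (fst b)) n (\<lambda>i\<in>tree_index.
            branch_vector (\<lambda>i. X (j # i)) (\<lambda>i. N (j # i)) (\<lambda>i. C (j # i)) i \<omega>)"
      using Suc.prems[of "j # _"] j by (intro Suc.IH) simp
    also have "(\<lambda>i\<in>tree_index.
          branch_vector (\<lambda>i. X (j # i)) (\<lambda>i. N (j # i)) (\<lambda>i. C (j # i)) i \<omega>) = subtree j ?v"
      using j by (auto simp: subtree_def branch_vector_def fun_eq_iff)
    finally show ?thesis using j by (simp add: branch_vector_def)
  qed
  have "generation (\<lambda>i. N i \<omega>) (Suc n) = (\<lambda>(j, i). j # i) ` Sigma (children (N [] \<omega>)) gen"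
    unfolding generation_Suc_Cons by (force simp: gen_def)
  then have "tree_sum N C X (Suc n) \<omega>
      = (\<Sum>\<^sub>\<infinity>i\<in>(\<lambda>(j, i). j # i) ` Sigma (children (N [] \<omega>)) gen. summand i)"
    by (simp only: tree_sum_def summand_def)
  also have "\<dots> = (\<Sum>\<^sub>\<infinity>(j, i)\<in>Sigma (children (N [] \<omega>)) gen. summand (j # i))"
    by (subst infsum_reindex) (auto simp: inj_on_def intro!: infsum_cong)
  also have "\<dots> = (\<Sum>\<^sub>\<infinity>j\<in>children (N [] \<omega>). \<Sum>\<^sub>\<infinity>i\<in>gen j. summand (j # i))"
    by (rule infsum_Sigma_ennreal)
  also have "\<dots> = weighted_sum ennreal (\<lambda>b. ennreal (fst b)) (Suc n) ?v"
  proof -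
    have root: "fst (snd (?v [])) = N [] \<omega>"
      by (simp add: branch_vector_def)
    show ?thesis
      unfolding weighted_sum.simps(2) root by (rule infsum_cong) (rule step)
  qed
  finally show ?case .
qed

lemma borel_measurable_infsum_children:
  fixes f :: "nat \<Rightarrow> 'a \<Rightarrow> ennreal"
  assumes [measurable]: "n \<in> measurable M (count_space UNIV)"
    and f: "\<And>j. 1 \<le> j \<Longrightarrow> f j \<in> borel_measurable M"
  shows "(\<lambda>x. \<Sum>\<^sub>\<infinity>j\<in>children (n x). f j x) \<in> borel_measurable M"
proof -
  have [measurable]: "f (Suc k) \<in> borel_measurable M" for k
    by (rule f) simp
  show ?thesis unfolding infsum_children by measurable
qed

lemma measurable_mark [measurable]:
  "fst \<in> borel_measurable branch_space"
  "(\<lambda>b. fst (snd b)) \<in> measurable branch_space (count_space UNIV)"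
  unfolding branch_space_def by measurable

lemma measurable_mark_factor:
  "1 \<le> j \<Longrightarrow> (\<lambda>b. snd (snd b) j) \<in> borel_measurable branch_space"
  unfolding branch_space_def by measurable

lemma measurable_subtree:
  "1 \<le> j \<Longrightarrow> subtree j \<in> measurable (\<Pi>\<^sub>M i\<in>tree_index. branch_space) (\<Pi>\<^sub>M i\<in>tree_index. branch_space)"
  unfolding subtree_def by (intro measurable_restrict measurable_component_singleton) simp

lemma measurable_weighted_sum:
  assumes [measurable]: "h \<in> borel_measurable borel" "g \<in> borel_measurable branch_space"
  shows "weighted_sum h g n \<in> borel_measurable (\<Pi>\<^sub>M i\<in>tree_index. branch_space)"
proof (induction n)
  case (Suc n)
  have root [measurable]: "(\<lambda>v. v []) \<in> measurable (\<Pi>\<^sub>M i\<in>tree_index. branch_space) branch_space"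
    by (rule measurable_component_singleton) simp
  have "(\<lambda>v. h (snd (snd (v [])) j) * weighted_sum h g n (subtree j v))
      \<in> borel_measurable (\<Pi>\<^sub>M i\<in>tree_index. branch_space)" if "1 \<le> j" for j
    using measurable_compose[OF root measurable_mark_factor[OF that]]
      measurable_compose[OF measurable_subtree[OF that] Suc.IH]
    by measurable
  moreover have "(\<lambda>v. fst (snd (v []))) \<in> measurable (\<Pi>\<^sub>M i\<in>tree_index. branch_space) (count_space UNIV)"
    by (rule measurable_compose[OF root measurable_mark(2)])
  ultimately show ?case
    by (simp add: borel_measurable_infsum_children)
qed simp

text \<open>The identity with \<open>weighted_sum\<close> needs nonnegative factors, which hold only almost surely, whereas the
  image law in \<open>real_law\<close> requires measurability everywhere. So measurability is read off the definition,
  as a sum over all of the countably many words, weighted by membership in the generation.\<close>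

lemma measurable_tree_sum:
  assumes V: "\<And>i. i \<in> tree_index \<Longrightarrow> branch_vector X N C i \<in> measurable M branch_space"
  shows "tree_sum N C X n \<in> borel_measurable M"
proof -
  have X: "X i \<in> borel_measurable M" and N: "N i \<in> measurable M (count_space UNIV)"
    if "i \<in> tree_index" for i
    using measurable_compose[OF V[OF that] measurable_mark(1)]
      measurable_compose[OF V[OF that] measurable_mark(2)]
    by (simp_all add: branch_vector_def)
  have C: "C (i @ [j]) \<in> borel_measurable M" if "i \<in> tree_index" "1 \<le> j" for i j
    using measurable_compose[OF V[OF that(1)] measurable_mark_factor[OF that(2)]] that
    by (simp add: branch_vector_def)
  have weight: "(\<lambda>\<omega>. weight (\<lambda>i. C i \<omega>) i) \<in> borel_measurable M" if "i \<in> tree_index" for i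
    using that
  proof (induction i rule: rev_induct)
    case (snoc j i)
    then show ?case using C[of i j] by (simp add: weight_snoc borel_measurable_times)
  qed (simp add: weight_Nil)
  have gen: "Measurable.pred M (\<lambda>\<omega>. i \<in> generation (\<lambda>i. N i \<omega>) n)" for i
  proof (induction n arbitrary: i)
    case (Suc n)
    have "Measurable.pred M (\<lambda>\<omega>. i \<in> generation (\<lambda>i. N i \<omega>) n \<and> j \<in> children (N i \<omega>))" for i j
    proof (cases "i \<in> tree_index")
      case True
      note [measurable] = N[OF True] Suc
      show ?thesis unfolding children_def by measurable
    next
      case False
      then have "(\<lambda>\<omega>. i \<in> generation (\<lambda>i. N i \<omega>) n \<and> j \<in> children (N i \<omega>)) = (\<lambda>_. False)"
        using generation_subset_tree_index by blast
      then show ?thesis by simp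
    qed
    then show ?case
      by (cases i rule: rev_cases) auto
  qed simp
  have "(\<lambda>\<omega>. if i \<in> generation (\<lambda>i. N i \<omega>) n then ennreal (X i \<omega> * weight (\<lambda>i. C i \<omega>) i) else 0)
      \<in> borel_measurable M" for i
  proof (cases "i \<in> tree_index")
    case True
    note [measurable] = X[OF True] weight[OF True] gen
    show ?thesis by measurable
  next
    case False
    then have "(\<lambda>\<omega>. if i \<in> generation (\<lambda>i. N i \<omega>) n then ennreal (X i \<omega> * weight (\<lambda>i. C i \<omega>) i) else 0)
        = (\<lambda>_. 0)"
      using generation_subset_tree_index by (auto simp: fun_eq_iff)
    then show ?thesis by simp
  qed
  then have "(\<lambda>\<omega>. \<Sum>\<^sub>\<infinity>i. if i \<in> generation (\<lambda>i. N i \<omega>) n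
      then ennreal (X i \<omega> * weight (\<lambda>i. C i \<omega>) i) else 0) \<in> borel_measurable M"
    by (rule borel_measurable_infsum_list)
  moreover have "tree_sum N C X n = (\<lambda>\<omega>. \<Sum>\<^sub>\<infinity>i. if i \<in> generation (\<lambda>i. N i \<omega>) n
      then ennreal (X i \<omega> * weight (\<lambda>i. C i \<omega>) i) else 0)"
    unfolding tree_sum_def fun_eq_iff by (intro allI infsum_cong_neutral) auto
  ultimately show ?thesis by simp
qed

text \<open>Subadditivity is applied once per generation, over the children of the root.\<close>

lemma ennreal_powr_weighted_sum_le:
  assumes b: "0 < b" "b \<le> 1"
  shows "ennreal_powr b (weighted_sum ennreal (\<lambda>m. ennreal (fst m)) n v)
    \<le> weighted_sum (\<lambda>c. ennreal (c powr b)) (\<lambda>m. ennreal (fst m powr b)) n v"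
proof (induction n arbitrary: v)
  case 0
  show ?case by (simp add: ennreal_powr_ennreal_le)
next
  case (Suc n)
  have "ennreal_powr b (weighted_sum ennreal (\<lambda>m. ennreal (fst m)) (Suc n) v)
      \<le> (\<Sum>\<^sub>\<infinity>j\<in>children (fst (snd (v []))).
          ennreal_powr b (ennreal (snd (snd (v [])) j) *
            weighted_sum ennreal (\<lambda>m. ennreal (fst m)) n (subtree j v)))"
    by (simp add: ennreal_powr_infsum_children_le[OF b])
  also have "\<dots> \<le> weighted_sum (\<lambda>c. ennreal (c powr b)) (\<lambda>m. ennreal (fst m powr b)) (Suc n) v"
    by (simp add: ennreal_powr_mult[OF b(1)])
      (intro infsum_children_mono mult_mono ennreal_powr_ennreal_le Suc.IH, auto)
  finally show ?case .
qed

definition weighted_total :: "(nat list \<Rightarrow> mark) \<Rightarrow> ennreal" where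
  "weighted_total v = (\<Sum>n. weighted_sum ennreal (\<lambda>m. ennreal (fst m)) n v)"

text \<open>This is \<open>R = Q + \<Sum>\<^sub>j C\<^sub>j R\<^sub>j\<close> for a single configuration; interchanging the sum over generations
  with the sum over children is harmless as all terms are nonnegative.\<close>

lemma weighted_total_recursion:
  "weighted_total v = (\<Sum>\<^sub>\<infinity>j\<in>children (fst (snd (v []))).
      ennreal (snd (snd (v [])) j) * weighted_total (subtree j v)) + ennreal (fst (v []))"
proof -
  have "weighted_total v = (\<Sum>n. weighted_sum ennreal (\<lambda>m. ennreal (fst m)) (Suc n) v)
      + weighted_sum ennreal (\<lambda>m. ennreal (fst m)) 0 v"
    using suminf_offset[of "\<lambda>n. weighted_sum ennreal (\<lambda>m. ennreal (fst m)) n v" 1]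
    by (simp add: weighted_total_def add.commute)
  then show ?thesis
    by (simp add: suminf_infsum_ennreal weighted_total_def)
qed

lemma measurable_weighted_total [measurable]:
  "weighted_total \<in> borel_measurable (\<Pi>\<^sub>M i\<in>tree_index. branch_space)"
proof -
  have [measurable]: "weighted_sum ennreal (\<lambda>m. ennreal (fst m)) n
      \<in> borel_measurable (\<Pi>\<^sub>M i\<in>tree_index. branch_space)" for n
    by (rule measurable_weighted_sum) measurable
  show ?thesis unfolding weighted_total_def[abs_def] by measurable
qed

section \<open>The branching property\<close>

context weighted_branching_tree
begin

definition config :: "'a \<Rightarrow> nat list \<Rightarrow> mark" where
  "config \<omega> = (\<lambda>i\<in>tree_index. branch_vector Q N C i \<omega>)"

definition branch_law :: "mark measure" where
  "branch_law = distr M branch_space (branch_vector Q N C [])"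

lemma indep_branch: "indep_vars (\<lambda>_. branch_space) (branch_vector Q N C) tree_index"
  using iid_branch unfolding iid_vars_def by (rule conjunct1)

lemma measurable_branch:
  "i \<in> tree_index \<Longrightarrow> branch_vector Q N C i \<in> measurable M branch_space"
  using indep_branch by (simp add: indep_vars_def)

lemma distr_branch: "i \<in> tree_index \<Longrightarrow> distr M branch_space (branch_vector Q N C i) = branch_law"
  using iid_branch Nil_in_tree_index unfolding iid_vars_def branch_law_def by blast

lemma sets_branch_law [measurable_cong, simp]: "sets branch_law = sets branch_space"
  by (simp add: branch_law_def)

lemma prob_space_branch_law: "prob_space branch_law"
  unfolding branch_law_def by (rule prob_space_distr) (rule measurable_branch, simp)

lemma measurable_config [measurable]: "config \<in> measurable M (\<Pi>\<^sub>M i\<in>tree_index. branch_space)"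
  unfolding config_def by (rule measurable_restrict) (rule measurable_branch)

lemma distr_config:
  "distr M (\<Pi>\<^sub>M i\<in>tree_index. branch_space) config = (\<Pi>\<^sub>M i\<in>tree_index. branch_law)"
proof -
  have "distr M (\<Pi>\<^sub>M i\<in>tree_index. branch_space) config
      = (\<Pi>\<^sub>M i\<in>tree_index. distr M branch_space (branch_vector Q N C i))"
    unfolding config_def using indep_branch
    by (subst (asm) indep_vars_iff_distr_eq_PiM') (auto intro: measurable_branch Nil_in_tree_index)
  also have "\<dots> = (\<Pi>\<^sub>M i\<in>tree_index. branch_law)"
    by (rule PiM_cong) (auto simp: distr_branch)
  finally show ?thesis .
qed

text \<open>The shift to the child \<open>j\<close> picks out an injectively indexed subfamily of an iid family.\<close>

lemma distr_subtree:
  assumes j: "1 \<le> j"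
  shows "distr M (\<Pi>\<^sub>M i\<in>tree_index. branch_space) (\<lambda>\<omega>. subtree j (config \<omega>))
    = distr M (\<Pi>\<^sub>M i\<in>tree_index. branch_space) config"
proof -
  have sets: "sets (\<Pi>\<^sub>M i\<in>tree_index. branch_space) = sets (\<Pi>\<^sub>M i\<in>tree_index. branch_law)"
    by (rule sets_PiM_cong) auto
  have "distr M (\<Pi>\<^sub>M i\<in>tree_index. branch_space) (\<lambda>\<omega>. subtree j (config \<omega>))
      = distr (distr M (\<Pi>\<^sub>M i\<in>tree_index. branch_space) config)
          (\<Pi>\<^sub>M i\<in>tree_index. branch_space) (subtree j)"
    by (subst distr_distr) (auto simp: measurable_subtree[OF j] o_def)
  also have "\<dots> = distr (\<Pi>\<^sub>M i\<in>tree_index. branch_law) (\<Pi>\<^sub>M i\<in>tree_index. branch_law) (subtree j)"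
    unfolding distr_config by (rule distr_cong) (auto simp: sets)
  also have "\<dots> = (\<Pi>\<^sub>M i\<in>tree_index. branch_law)"
    unfolding subtree_def using j
    by (intro distr_PiM_reindex[where f = "(#) j" and M = "\<lambda>_. branch_law"])
      (auto simp: prob_space_branch_law inj_on_def)
  finally show ?thesis by (simp add: distr_config)
qed

text \<open>The root and the subtrees of the children use disjoint blocks of an iid family of marks, so the root
  vector is independent of the family of subtrees, and the subtrees are independent of each other; by
  \<open>distr_subtree\<close> each of them is distributed as the whole tree.\<close>

lemma branching_property:
  assumes F [measurable]: "F \<in> measurable (\<Pi>\<^sub>M i\<in>tree_index. branch_space) S"
  shows "distr M (branch_space \<Otimes>\<^sub>M (\<Pi>\<^sub>M j\<in>{1..}. S))
      (\<lambda>\<omega>. (branch_vector Q N C [] \<omega>, \<lambda>j\<in>{1..}. F (subtree j (config \<omega>))))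
    = branch_law \<Otimes>\<^sub>M (\<Pi>\<^sub>M j\<in>{1..}. distr M S (\<lambda>\<omega>. F (config \<omega>)))"
proof -
  let ?V = "branch_vector Q N C"
  let ?T = "tree_index - {[]}"
  let ?X = "\<lambda>\<omega>. restrict (\<lambda>i. ?V i \<omega>) {[]}"
  let ?Y = "\<lambda>\<omega>. restrict (\<lambda>i. ?V i \<omega>) ?T"
  define f :: "(nat list \<Rightarrow> mark) \<Rightarrow> mark" where "f v = v []" for v
  define g where "g v = (\<lambda>j\<in>{1..}. F (subtree j v))" for v
  have indep: "indep_var (\<Pi>\<^sub>M i\<in>{[] :: nat list}. branch_space) ?X (\<Pi>\<^sub>M i\<in>?T. branch_space) ?Y"
    by (rule indep_var_restrict[OF indep_branch, of "{[]}" ?T])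
      (simp_all add: subset_eq)
  then have X [measurable]: "?X \<in> measurable M (\<Pi>\<^sub>M i\<in>{[] :: nat list}. branch_space)"
    and Y [measurable]: "?Y \<in> measurable M (\<Pi>\<^sub>M i\<in>?T. branch_space)"
    and joint: "distr M (\<Pi>\<^sub>M i\<in>{[] :: nat list}. branch_space) ?X \<Otimes>\<^sub>M distr M (\<Pi>\<^sub>M i\<in>?T. branch_space) ?Y
      = distr M ((\<Pi>\<^sub>M i\<in>{[] :: nat list}. branch_space) \<Otimes>\<^sub>M (\<Pi>\<^sub>M i\<in>?T. branch_space)) (\<lambda>\<omega>. (?X \<omega>, ?Y \<omega>))"
    by (blast dest: indep_var_distribution_eq[THEN iffD1])+
  have f [measurable]: "f \<in> measurable (\<Pi>\<^sub>M i\<in>{[] :: nat list}. branch_space) branch_space"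
    unfolding f_def by (rule measurable_component_singleton) simp
  have sub: "subtree j \<in> measurable (\<Pi>\<^sub>M i\<in>?T. branch_space) (\<Pi>\<^sub>M i\<in>tree_index. branch_space)"
    if "1 \<le> j" for j
    unfolding subtree_def using that by (intro measurable_restrict measurable_component_singleton) simp
  have g [measurable]: "g \<in> measurable (\<Pi>\<^sub>M i\<in>?T. branch_space) (\<Pi>\<^sub>M j\<in>{1..}. S)"
    unfolding g_def by (intro measurable_restrict measurable_compose[OF sub F]) simp
  have subY: "subtree j (?Y \<omega>) = subtree j (config \<omega>)" if "1 \<le> j" for j \<omega>
    using that by (auto simp: subtree_def config_def)
  then have gY: "g (?Y \<omega>) = (\<lambda>j\<in>{1..}. F (subtree j (config \<omega>)))" for \<omega>
    by (auto simp: g_def)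
  have fX: "f (?X \<omega>) = ?V [] \<omega>" for \<omega>
    by (simp add: f_def)
  have "distr M (branch_space \<Otimes>\<^sub>M (\<Pi>\<^sub>M j\<in>{1..}. S))
      (\<lambda>\<omega>. (?V [] \<omega>, \<lambda>j\<in>{1..}. F (subtree j (config \<omega>))))
      = distr (distr M ((\<Pi>\<^sub>M i\<in>{[] :: nat list}. branch_space) \<Otimes>\<^sub>M (\<Pi>\<^sub>M i\<in>?T. branch_space)) (\<lambda>\<omega>. (?X \<omega>, ?Y \<omega>)))
          (branch_space \<Otimes>\<^sub>M (\<Pi>\<^sub>M j\<in>{1..}. S)) (\<lambda>(x, y). (f x, g y))"
    by (subst distr_distr) (measurable, simp add: o_def fX gY)
  also have "\<dots> = distr (distr M (\<Pi>\<^sub>M i\<in>{[] :: nat list}. branch_space) ?X) branch_space f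
      \<Otimes>\<^sub>M distr (distr M (\<Pi>\<^sub>M i\<in>?T. branch_space) ?Y) (\<Pi>\<^sub>M j\<in>{1..}. S) g"
    unfolding joint[symmetric]
    by (rule pair_measure_distr[symmetric])
      (measurable, intro prob_space_imp_sigma_finite prob_space.prob_space_distr prob_space_distr, measurable)
  also have "distr (distr M (\<Pi>\<^sub>M i\<in>{[] :: nat list}. branch_space) ?X) branch_space f = branch_law"
    by (subst distr_distr) (measurable, simp add: o_def fX branch_law_def)
  also have "distr (distr M (\<Pi>\<^sub>M i\<in>?T. branch_space) ?Y) (\<Pi>\<^sub>M j\<in>{1..}. S) g
      = distr M (\<Pi>\<^sub>M j\<in>{1..}. S) (\<lambda>\<omega>. \<lambda>j\<in>{1..}. F (subtree j (config \<omega>)))"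
    by (subst distr_distr) (measurable, simp add: o_def gY)
  also have "\<dots> = (\<Pi>\<^sub>M j\<in>{1..}. distr M S (\<lambda>\<omega>. F (subtree j (config \<omega>))))"
  proof -
    let ?K = "\<lambda>j. (#) j ` tree_index"
    have "indep_vars (\<lambda>j. \<Pi>\<^sub>M i\<in>?K j. branch_space) (\<lambda>j \<omega>. restrict (\<lambda>i. ?V i \<omega>) (?K j)) {1..}"
      by (rule indep_vars_restrict[OF indep_branch]) (auto simp: disjoint_family_on_def)
    then have "indep_vars (\<lambda>_. S) (\<lambda>j \<omega>. F (subtree j (restrict (\<lambda>i. ?V i \<omega>) (?K j)))) {1..}"
    proof (rule indep_vars_compose2)
      fix j :: nat
      have "subtree j \<in> measurable (\<Pi>\<^sub>M i\<in>?K j. branch_space) (\<Pi>\<^sub>M i\<in>tree_index. branch_space)"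
        unfolding subtree_def by (intro measurable_restrict measurable_component_singleton) simp
      then show "(\<lambda>v. F (subtree j v)) \<in> measurable (\<Pi>\<^sub>M i\<in>?K j. branch_space) S"
        by (rule measurable_compose) (rule F)
    qed
    moreover have "subtree j (restrict (\<lambda>i. ?V i \<omega>) (?K j)) = subtree j (config \<omega>)" if "1 \<le> j" for j \<omega>
      using that by (auto simp: subtree_def config_def)
    ultimately have "indep_vars (\<lambda>_. S) (\<lambda>j \<omega>. F (subtree j (config \<omega>))) {1..}"
      by (subst indep_vars_cong) auto
    moreover have "(\<lambda>\<omega>. F (subtree j (config \<omega>))) \<in> measurable M S" if "j \<in> {1..}" for j
      using that by (intro measurable_compose[OF measurable_config]
          measurable_compose[OF measurable_subtree F]) simp
    ultimately show ?thesis
      by (subst (asm) indep_vars_iff_distr_eq_PiM') auto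
  qed
  also have "\<dots> = (\<Pi>\<^sub>M j\<in>{1..}. distr M S (\<lambda>\<omega>. F (config \<omega>)))"
  proof (rule PiM_cong[OF refl])
    fix j :: nat assume "j \<in> {1..}"
    then have j: "1 \<le> j" by simp
    have "distr M S (\<lambda>\<omega>. F (subtree j (config \<omega>)))
        = distr (distr M (\<Pi>\<^sub>M i\<in>tree_index. branch_space) (\<lambda>\<omega>. subtree j (config \<omega>))) S F"
      using measurable_compose[OF measurable_config measurable_subtree[OF j]]
      by (subst distr_distr) (auto simp: o_def)
    also have "\<dots> = distr M S (\<lambda>\<omega>. F (config \<omega>))"
      unfolding distr_subtree[OF j] by (subst distr_distr) (auto simp: o_def)
    finally show "distr M S (\<lambda>\<omega>. F (subtree j (config \<omega>))) = distr M S (\<lambda>\<omega>. F (config \<omega>))" .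
  qed
  finally show ?thesis .
qed

end

text \<open>Conditionally on \<open>b\<close> every \<open>u (r j)\<close> has the same mean, so that mean factors out of the sum. The
  lemma serves twice: for the means of the tree sums and for the contraction of coupling costs.\<close>

lemma nn_integral_offspring:
  fixes a :: "nat \<Rightarrow> mark \<Rightarrow> ennreal"
  assumes B: "prob_space B" "sets B = sets branch_space" and P: "prob_space P"
    and a: "\<And>j. 1 \<le> j \<Longrightarrow> a j \<in> borel_measurable branch_space"
    and u [measurable]: "u \<in> borel_measurable P"
  shows "(\<integral>\<^sup>+(b, r). (\<Sum>\<^sub>\<infinity>j\<in>children (fst (snd b)). a j b * u (r j)) \<partial>(B \<Otimes>\<^sub>M (\<Pi>\<^sub>M j\<in>{1..}. P)))
    = (\<integral>\<^sup>+b. (\<Sum>\<^sub>\<infinity>j\<in>children (fst (snd b)). a j b) \<partial>B) * (\<integral>\<^sup>+x. u x \<partial>P)"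
proof -
  interpret B: prob_space B by fact
  interpret P: prob_space P by fact
  let ?P = "\<Pi>\<^sub>M j\<in>{1::nat..}. P"
  interpret PP: prob_space ?P by (rule prob_space_PiM) (rule P)
  note [measurable_cong] = B(2)
  have [measurable]: "a (Suc k) \<in> borel_measurable branch_space" for k by (rule a) simp
  have [measurable]: "(\<lambda>r. r (Suc k)) \<in> measurable ?P P" for k
    by (rule measurable_component_singleton) simp
  have comp: "(\<integral>\<^sup>+r. u (r (Suc k)) \<partial>?P) = (\<integral>\<^sup>+x. u x \<partial>P)" for k
  proof -
    have "(\<integral>\<^sup>+x. u x \<partial>P) = (\<integral>\<^sup>+x. u x \<partial>distr ?P P (\<lambda>r. r (Suc k)))"
      by (subst distr_PiM_component) (auto intro: P)
    then show ?thesis by (simp add: nn_integral_distr)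
  qed
  have "(\<integral>\<^sup>+(b, r). (\<Sum>\<^sub>\<infinity>j\<in>children (fst (snd b)). a j b * u (r j)) \<partial>(B \<Otimes>\<^sub>M ?P))
      = (\<integral>\<^sup>+b. \<integral>\<^sup>+r. (\<Sum>k. if enat (Suc k) \<le> fst (snd b)
          then a (Suc k) b * u (r (Suc k)) else 0) \<partial>?P \<partial>B)"
    unfolding infsum_children by (subst PP.nn_integral_fst[symmetric]) (simp_all, measurable)
  also have "\<dots> = (\<integral>\<^sup>+b. (\<Sum>k. if enat (Suc k) \<le> fst (snd b)
          then a (Suc k) b else 0) * (\<integral>\<^sup>+x. u x \<partial>P) \<partial>B)"
  proof (rule nn_integral_cong)
    fix b assume "b \<in> space B"
    have "(\<integral>\<^sup>+r. (\<Sum>k. if enat (Suc k) \<le> fst (snd b) then a (Suc k) b * u (r (Suc k)) else 0) \<partial>?P)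
        = (\<Sum>k. \<integral>\<^sup>+r. (if enat (Suc k) \<le> fst (snd b) then a (Suc k) b else 0) * u (r (Suc k)) \<partial>?P)"
      by (subst nn_integral_suminf[symmetric]) (auto intro!: nn_integral_cong suminf_cong)
    also have "\<dots> = (\<Sum>k. (if enat (Suc k) \<le> fst (snd b) then a (Suc k) b else 0) * (\<integral>\<^sup>+x. u x \<partial>P))"
      by (subst nn_integral_cmult) (measurable, simp only: comp)
    finally show "(\<integral>\<^sup>+r. (\<Sum>k. if enat (Suc k) \<le> fst (snd b)
          then a (Suc k) b * u (r (Suc k)) else 0) \<partial>?P)
        = (\<Sum>k. if enat (Suc k) \<le> fst (snd b) then a (Suc k) b else 0) * (\<integral>\<^sup>+x. u x \<partial>P)"
      by simp
  qed
  also have "\<dots> = (\<integral>\<^sup>+b. (\<Sum>\<^sub>\<infinity>j\<in>children (fst (snd b)). a j b) \<partial>B) * (\<integral>\<^sup>+x. u x \<partial>P)"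
  proof -
    have "(\<lambda>b. \<Sum>\<^sub>\<infinity>j\<in>children (fst (snd b)). a j b) \<in> borel_measurable branch_space"
      by (rule borel_measurable_infsum_children[OF measurable_mark(2) a])
    then have "(\<lambda>b. \<Sum>\<^sub>\<infinity>j\<in>children (fst (snd b)). a j b) \<in> borel_measurable B"
      by (simp cong: measurable_cong_sets)
    then show ?thesis
      unfolding infsum_children by (rule nn_integral_multc)
  qed
  finally show ?thesis .
qed

lemma measurable_offspring_sum:
  fixes f :: "nat \<Rightarrow> mark \<times> 'p \<Rightarrow> ennreal"
  assumes "\<And>j. 1 \<le> j \<Longrightarrow> f j \<in> borel_measurable (branch_space \<Otimes>\<^sub>M P)"
  shows "(\<lambda>x. \<Sum>\<^sub>\<infinity>j\<in>children (fst (snd (fst x))). f j x) \<in> borel_measurable (branch_space \<Otimes>\<^sub>M P)"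
proof (rule borel_measurable_infsum_children)
  show "(\<lambda>x. fst (snd (fst x))) \<in> measurable (branch_space \<Otimes>\<^sub>M P) (count_space UNIV)"
    by (rule measurable_compose[OF measurable_fst measurable_mark(2)])
qed (rule assms)

lemma recursion_value_eq:
  "recursion_value x = (\<Sum>\<^sub>\<infinity>j\<in>children (fst (snd (fst x))). ennreal (snd (snd (fst x)) j * snd x j))
    + ennreal (fst (fst x))"
  by (simp add: recursion_value_def case_prod_beta)

lemma measurable_recursion_value:
  "recursion_value \<in> borel_measurable (branch_space \<Otimes>\<^sub>M (\<Pi>\<^sub>M j\<in>{1..}. borel))"
proof -
  let ?P = "\<Pi>\<^sub>M j\<in>{1::nat..}. (borel :: real measure)"
  have "(\<lambda>x. ennreal (snd (snd (fst x)) j * snd x j)) \<in> borel_measurable (branch_space \<Otimes>\<^sub>M ?P)"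
    if "1 \<le> j" for j
  proof -
    have [measurable]: "(\<lambda>x. snd (snd (fst x)) j) \<in> borel_measurable (branch_space \<Otimes>\<^sub>M ?P)"
      using that by (intro measurable_compose[OF measurable_fst measurable_mark_factor])
    have [measurable]: "(\<lambda>x. snd x j) \<in> borel_measurable (branch_space \<Otimes>\<^sub>M ?P)"
      using that by (intro measurable_compose[OF measurable_snd measurable_component_singleton]) simp
    show ?thesis by measurable
  qed
  then have [measurable]: "(\<lambda>x. \<Sum>\<^sub>\<infinity>j\<in>children (fst (snd (fst x))). ennreal (snd (snd (fst x)) j * snd x j))
      \<in> borel_measurable (branch_space \<Otimes>\<^sub>M ?P)"
    by (rule measurable_offspring_sum)
  have [measurable]: "(\<lambda>x. fst (fst x)) \<in> borel_measurable (branch_space \<Otimes>\<^sub>M ?P)"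
    by (rule measurable_compose[OF measurable_fst measurable_mark(1)])
  show ?thesis
    unfolding recursion_value_eq[abs_def] by measurable
qed

context weighted_branching_tree
begin

text \<open>Each generation contributes one independent factor \<open>E[\<Sum>\<^sub>j h(C\<^sub>j)]\<close>: by the branching property the mean of
  generation \<open>n + 1\<close> is that factor times the mean of generation \<open>n\<close> of a subtree.\<close>

lemma nn_integral_weighted_sum:
  assumes h [measurable]: "h \<in> borel_measurable borel"
    and g [measurable]: "g \<in> borel_measurable branch_space"
  shows "(\<integral>\<^sup>+\<omega>. weighted_sum h g n (config \<omega>) \<partial>M)
    = (\<integral>\<^sup>+b. (\<Sum>\<^sub>\<infinity>j\<in>children (fst (snd b)). h (snd (snd b) j)) \<partial>branch_law) ^ n
      * (\<integral>\<^sup>+b. g b \<partial>branch_law)"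
proof (induction n)
  case 0
  show ?case
    by (simp add: config_def branch_law_def nn_integral_distr measurable_branch)
next
  case (Suc n)
  let ?F = "weighted_sum h g n"
  let ?P = "\<Pi>\<^sub>M j\<in>{1::nat..}. (borel :: ennreal measure)"
  let ?s = "\<lambda>(b :: mark, r :: nat \<Rightarrow> ennreal).
      \<Sum>\<^sub>\<infinity>j\<in>children (fst (snd b)). h (snd (snd b) j) * r j"
  define law where "law = distr M borel (\<lambda>\<omega>. ?F (config \<omega>))"
  have F: "?F \<in> borel_measurable (\<Pi>\<^sub>M i\<in>tree_index. branch_space)"
    by (rule measurable_weighted_sum) fact+
  have F_config [measurable]: "(\<lambda>\<omega>. ?F (config \<omega>)) \<in> borel_measurable M"
    by (rule measurable_compose[OF measurable_config F])
  have s: "?s \<in> borel_measurable (branch_space \<Otimes>\<^sub>M ?P)"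
    unfolding case_prod_beta
  proof (rule measurable_offspring_sum)
    fix j :: nat assume j: "1 \<le> j"
    have [measurable]: "(\<lambda>x. snd (snd (fst x)) j) \<in> borel_measurable (branch_space \<Otimes>\<^sub>M ?P)"
      using j by (intro measurable_compose[OF measurable_fst measurable_mark_factor])
    have [measurable]: "(\<lambda>x. snd x j) \<in> borel_measurable (branch_space \<Otimes>\<^sub>M ?P)"
      using j by (intro measurable_compose[OF measurable_snd measurable_component_singleton]) simp
    show "(\<lambda>x. h (snd (snd (fst x)) j) * snd x j) \<in> borel_measurable (branch_space \<Otimes>\<^sub>M ?P)"
      by measurable
  qed
  have joint: "(\<lambda>\<omega>. (branch_vector Q N C [] \<omega>, \<lambda>j\<in>{1..}. ?F (subtree j (config \<omega>))))
      \<in> measurable M (branch_space \<Otimes>\<^sub>M ?P)"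
    by (intro measurable_Pair measurable_branch measurable_restrict
        measurable_compose[OF measurable_config] measurable_compose[OF measurable_subtree F]) auto
  have "(\<integral>\<^sup>+\<omega>. weighted_sum h g (Suc n) (config \<omega>) \<partial>M)
      = (\<integral>\<^sup>+\<omega>. ?s (branch_vector Q N C [] \<omega>, \<lambda>j\<in>{1..}. ?F (subtree j (config \<omega>))) \<partial>M)"
    by (intro nn_integral_cong)
      (auto simp: config_def intro!: infsum_cong dest: children_ge_1)
  also have "\<dots> = (\<integral>\<^sup>+x. ?s x \<partial>distr M (branch_space \<Otimes>\<^sub>M ?P)
      (\<lambda>\<omega>. (branch_vector Q N C [] \<omega>, \<lambda>j\<in>{1..}. ?F (subtree j (config \<omega>)))))"
    using s by (intro nn_integral_distr[symmetric] joint) simp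
  also have "\<dots> = (\<integral>\<^sup>+x. ?s x \<partial>(branch_law \<Otimes>\<^sub>M (\<Pi>\<^sub>M j\<in>{1..}. law)))"
    unfolding law_def by (subst branching_property[OF F]) (rule refl)
  also have "\<dots> = (\<integral>\<^sup>+b. (\<Sum>\<^sub>\<infinity>j\<in>children (fst (snd b)). h (snd (snd b) j)) \<partial>branch_law)
      * (\<integral>\<^sup>+x. x \<partial>law)"
  proof (rule nn_integral_offspring[OF prob_space_branch_law sets_branch_law])
    show "prob_space law"
      unfolding law_def by (rule prob_space_distr) measurable
    show "(\<lambda>b. h (snd (snd b) j)) \<in> borel_measurable branch_space" if "1 \<le> j" for j
      by (rule measurable_compose[OF measurable_mark_factor[OF that] h])
  qed (simp add: law_def)
  also have "(\<integral>\<^sup>+x. x \<partial>law) = (\<integral>\<^sup>+\<omega>. ?F (config \<omega>) \<partial>M)"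
    unfolding law_def by (rule nn_integral_distr) measurable
  finally show ?case
    by (simp add: Suc.IH mult.assoc)
qed

lemma measurable_tree_total: "tree_total Q N C \<in> borel_measurable M"
proof -
  have [measurable]: "tree_sum N C Q n \<in> borel_measurable M" for n
    by (rule measurable_tree_sum) (rule measurable_branch)
  show ?thesis unfolding tree_total_def[abs_def] by measurable
qed

end

section \<open>Existence: the tree sums have summable fractional moments\<close>

text \<open>The locale is instantiated twice: with the marks \<open>Q\<close> and with the initial values in their place.\<close>

locale contracting_branching_tree = weighted_branching_tree +
  fixes \<beta> :: real
  assumes nonneg: "AE \<omega> in M. 0 \<le> Q [] \<omega> \<and> (\<forall>j\<ge>1. 0 \<le> C [j] \<omega>)"
    and \<beta>: "0 < \<beta>" "\<beta> \<le> 1"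
    and moment: "(\<integral>\<^sup>+\<omega>. ennreal (Q [] \<omega> powr \<beta>) \<partial>M) < \<infinity>"
    and contraction: "(\<integral>\<^sup>+\<omega>. (\<Sum>\<^sub>\<infinity>i\<in>children (N [] \<omega>). ennreal (C [i] \<omega> powr \<beta>)) \<partial>M) < 1"
begin

lemma branch_law_nonneg:
  "AE b in branch_law. 0 \<le> fst b \<and> (\<forall>j\<ge>1. 0 \<le> snd (snd b) j)"
proof -
  have "Measurable.pred branch_space (\<lambda>b. 0 \<le> snd (snd b) (Suc k))" for k
    using measurable_mark_factor[of "Suc k"] by measurable
  then have meas: "Measurable.pred branch_space (\<lambda>b. 0 \<le> fst b \<and> (\<forall>k. 0 \<le> snd (snd b) (Suc k)))"
    by measurable
  have all: "(\<forall>j\<ge>1. 0 \<le> c j) \<longleftrightarrow> (\<forall>k. 0 \<le> c (Suc k))" for c :: "nat \<Rightarrow> real"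
    by (metis Suc_le_D Suc_le_mono One_nat_def le0)
  show ?thesis
    using nonneg meas unfolding all branch_law_def
    by (subst AE_distr_iff) (auto simp: measurable_branch branch_vector_def pred_def)
qed

lemma factor_moment:
  "(\<integral>\<^sup>+b. (\<Sum>\<^sub>\<infinity>j\<in>children (fst (snd b)). ennreal (snd (snd b) j powr \<beta>)) \<partial>branch_law) < 1"
proof -
  have "(\<lambda>b. ennreal (snd (snd b) j powr \<beta>)) \<in> borel_measurable branch_space" if "1 \<le> j" for j
    using measurable_mark_factor[OF that] by measurable
  then have "(\<integral>\<^sup>+b. (\<Sum>\<^sub>\<infinity>j\<in>children (fst (snd b)). ennreal (snd (snd b) j powr \<beta>)) \<partial>branch_law)
      = (\<integral>\<^sup>+\<omega>. (\<Sum>\<^sub>\<infinity>j\<in>children (N [] \<omega>).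
          ennreal (snd (snd (branch_vector Q N C [] \<omega>)) j powr \<beta>)) \<partial>M)"
    unfolding branch_law_def
    by (subst nn_integral_distr)
      (auto simp: measurable_branch borel_measurable_infsum_children[OF measurable_mark(2)]
        branch_vector_def)
  also have "\<dots> = (\<integral>\<^sup>+\<omega>. (\<Sum>\<^sub>\<infinity>i\<in>children (N [] \<omega>). ennreal (C [i] \<omega> powr \<beta>)) \<partial>M)"
    by (intro nn_integral_cong infsum_cong) (auto simp: branch_vector_def dest: children_ge_1)
  finally show ?thesis using contraction by simp
qed

text \<open>The bound is the geometric series \<open>\<Sum>\<^sub>n \<rho>\<^sup>n E[Q\<^sup>\<beta>]\<close>.\<close>

lemma nn_integral_ennreal_powr_weighted_total:
  "(\<integral>\<^sup>+\<omega>. ennreal_powr \<beta> (weighted_total (config \<omega>)) \<partial>M) < \<infinity>"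
proof -
  let ?h = "\<lambda>c. ennreal (c powr \<beta>)" and ?g = "\<lambda>m :: mark. ennreal (fst m powr \<beta>)"
  let ?\<rho> = "\<integral>\<^sup>+b. (\<Sum>\<^sub>\<infinity>j\<in>children (fst (snd b)). ennreal (snd (snd b) j powr \<beta>)) \<partial>branch_law"
  have [measurable]: "(\<lambda>\<omega>. weighted_sum ?h ?g n (config \<omega>)) \<in> borel_measurable M" for n
    by (rule measurable_compose[OF measurable_config measurable_weighted_sum]) measurable
  have "ennreal_powr \<beta> (weighted_total v) \<le> (\<Sum>n. weighted_sum ?h ?g n v)" for v
    unfolding weighted_total_def
    by (rule order_trans[OF ennreal_powr_suminf_le[OF \<beta>]])
      (intro suminf_le ennreal_powr_weighted_sum_le[OF \<beta>] summableI)
  then have "(\<integral>\<^sup>+\<omega>. ennreal_powr \<beta> (weighted_total (config \<omega>)) \<partial>M)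
      \<le> (\<integral>\<^sup>+\<omega>. (\<Sum>n. weighted_sum ?h ?g n (config \<omega>)) \<partial>M)"
    by (intro nn_integral_mono)
  also have "\<dots> = (\<Sum>n. ?\<rho> ^ n * (\<integral>\<^sup>+b. ?g b \<partial>branch_law))"
    by (subst nn_integral_suminf) (simp_all add: nn_integral_weighted_sum)
  also have "\<dots> = (\<Sum>n. ?\<rho> ^ n) * (\<integral>\<^sup>+b. ?g b \<partial>branch_law)"
    by simp
  also have "(\<integral>\<^sup>+b. ?g b \<partial>branch_law) = (\<integral>\<^sup>+\<omega>. ennreal (Q [] \<omega> powr \<beta>) \<partial>M)"
    unfolding branch_law_def
    by (subst nn_integral_distr) (auto simp: measurable_branch branch_vector_def)
  finally have le: "(\<integral>\<^sup>+\<omega>. ennreal_powr \<beta> (weighted_total (config \<omega>)) \<partial>M)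
      \<le> (\<Sum>n. ?\<rho> ^ n) * (\<integral>\<^sup>+\<omega>. ennreal (Q [] \<omega> powr \<beta>) \<partial>M)" .
  also have "\<dots> < \<infinity>"
    using ennreal_geometric_less_top[OF factor_moment] moment
    by (simp add: ennreal_mult_less_top)
  finally show ?thesis .
qed

lemma tree_total_eq_weighted_total: "AE \<omega> in M. tree_total Q N C \<omega> = weighted_total (config \<omega>)"
proof -
  have "AE \<omega> in M. \<forall>i\<in>tree_index. 0 \<le> fst (branch_vector Q N C i \<omega>) \<and>
      (\<forall>j\<ge>1. 0 \<le> snd (snd (branch_vector Q N C i \<omega>)) j)"
  proof (rule AE_ball_countable')
    fix i assume i: "i \<in> tree_index"
    show "AE \<omega> in M. 0 \<le> fst (branch_vector Q N C i \<omega>) \<and>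
        (\<forall>j\<ge>1. 0 \<le> snd (snd (branch_vector Q N C i \<omega>)) j)"
      using branch_law_nonneg unfolding distr_branch[OF i, symmetric]
      by (rule AE_distrD[OF measurable_branch[OF i]])
  qed simp
  then show ?thesis
  proof eventually_elim
    case (elim \<omega>)
    then have "tree_sum N C Q n \<omega> = weighted_sum ennreal (\<lambda>m. ennreal (fst m)) n (config \<omega>)" for n
      unfolding config_def by (intro tree_sum_eq_weighted_sum) (auto simp: branch_vector_def)
    then show ?case by (simp add: tree_total_def weighted_total_def)
  qed
qed

lemma weighted_total_finite: "AE \<omega> in M. weighted_total (config \<omega>) < \<infinity>"
proof -
  have "AE \<omega> in M. ennreal_powr \<beta> (weighted_total (config \<omega>)) \<noteq> \<infinity>"
    using nn_integral_ennreal_powr_weighted_total by (intro nn_integral_PInf_AE) auto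
  then show ?thesis
    by eventually_elim (metis ennreal_powr_less_top_iff less_top infinity_ennreal_def)
qed

lemma tree_total_finite: "AE \<omega> in M. tree_total Q N C \<omega> < \<infinity>"
  using tree_total_eq_weighted_total weighted_total_finite by eventually_elim simp

lemma tree_total_moment:
  "(\<integral>\<^sup>+\<omega>. ennreal (enn2real (tree_total Q N C \<omega>) powr \<beta>) \<partial>M) < \<infinity>"
proof -
  have "(\<integral>\<^sup>+\<omega>. ennreal (enn2real (tree_total Q N C \<omega>) powr \<beta>) \<partial>M)
      \<le> (\<integral>\<^sup>+\<omega>. ennreal_powr \<beta> (weighted_total (config \<omega>)) \<partial>M)"
    using tree_total_eq_weighted_total
    by (intro nn_integral_mono_AE, eventually_elim) (simp add: ennreal_powr_def)
  then show ?thesis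
    using nn_integral_ennreal_powr_weighted_total by (rule le_less_trans)
qed

lemma tree_sum_finite: "AE \<omega> in M. \<forall>n. tree_sum N C Q n \<omega> < \<infinity>"
  using tree_total_finite
  by eventually_elim (auto simp: tree_total_def intro: ennreal_suminf_lessD)

lemma tree_sum_tendsto_0: "AE \<omega> in M. (\<lambda>n. tree_sum N C Q n \<omega>) \<longlonglongrightarrow> 0"
  using tree_total_finite
  by eventually_elim (auto simp: tree_total_def intro: ennreal_terms_tendsto_0)

text \<open>The pathwise identity \<open>weighted_total_recursion\<close> is read in law with the branching property. Solutions
  are laws on the reals, so the totals of the subtrees enter through \<open>enn2real\<close>; this changes nothing
  because almost surely all these totals are finite.\<close>

lemma tree_total_solves_recursion:
  "recursion_solution (distr M branch_space (branch_vector Q N C [])) (real_law M (tree_total Q N C))"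
proof -
  let ?P = "\<Pi>\<^sub>M j\<in>{1::nat..}. (borel :: real measure)"
  let ?F = "\<lambda>v. enn2real (weighted_total v)"
  note [measurable] = measurable_tree_total
  have F: "?F \<in> borel_measurable (\<Pi>\<^sub>M i\<in>tree_index. branch_space)"
    by measurable
  have law: "real_law M (tree_total Q N C) = distr M borel (\<lambda>\<omega>. ?F (config \<omega>))"
    unfolding real_law_def using tree_total_eq_weighted_total
    by (intro distr_cong_AE) (auto elim!: eventually_mono intro: F measurable_compose[OF measurable_config])
  have joint: "(\<lambda>\<omega>. (branch_vector Q N C [] \<omega>, \<lambda>j\<in>{1..}. ?F (subtree j (config \<omega>))))
      \<in> measurable M (branch_space \<Otimes>\<^sub>M ?P)"
    by (intro measurable_Pair measurable_branch measurable_restrict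
        measurable_compose[OF measurable_config] measurable_compose[OF measurable_subtree F]) auto
  have "recursion_law branch_law (real_law M (tree_total Q N C))
      = distr (distr M (branch_space \<Otimes>\<^sub>M ?P)
          (\<lambda>\<omega>. (branch_vector Q N C [] \<omega>, \<lambda>j\<in>{1..}. ?F (subtree j (config \<omega>))))) borel recursion_value"
    unfolding recursion_law_def law branching_property[OF F] ..
  also have "\<dots> = distr M borel (\<lambda>\<omega>. recursion_value
      (branch_vector Q N C [] \<omega>, \<lambda>j\<in>{1..}. ?F (subtree j (config \<omega>))))"
    by (subst distr_distr[OF measurable_recursion_value joint]) (simp add: o_def)
  also have "\<dots> = distr M borel (tree_total Q N C)"
  proof (rule distr_cong_AE)
    \<comment> \<open>Finiteness of the total is a property of the law of the configuration, which the subtrees share.\<close>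
    have "AE v in distr M (\<Pi>\<^sub>M i\<in>tree_index. branch_space) config. weighted_total v < \<infinity>"
      using weighted_total_finite by (subst AE_distr_iff) measurable
    then have "AE \<omega> in M. weighted_total (subtree j (config \<omega>)) < \<infinity>" if "1 \<le> j" for j
      unfolding distr_subtree[OF that, symmetric]
      by (rule AE_distrD[rotated])
        (rule measurable_compose[OF measurable_config measurable_subtree[OF that]])
    then have "AE \<omega> in M. \<forall>j\<in>{1..}. weighted_total (subtree j (config \<omega>)) < \<infinity>"
      by (intro AE_ball_countable') auto
    then show "AE \<omega> in M. recursion_value
        (branch_vector Q N C [] \<omega>, \<lambda>j\<in>{1..}. ?F (subtree j (config \<omega>))) = tree_total Q N C \<omega>"
      using nonneg tree_total_eq_weighted_total
    proof eventually_elim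
      case (elim \<omega>)
      have root: "config \<omega> [] = branch_vector Q N C [] \<omega>" "fst (branch_vector Q N C [] \<omega>) = Q [] \<omega>"
          "fst (snd (branch_vector Q N C [] \<omega>)) = N [] \<omega>"
        by (simp_all add: config_def branch_vector_def)
      have "recursion_value (branch_vector Q N C [] \<omega>, \<lambda>j\<in>{1..}. ?F (subtree j (config \<omega>)))
          = (\<Sum>\<^sub>\<infinity>j\<in>children (N [] \<omega>). ennreal (snd (snd (branch_vector Q N C [] \<omega>)) j
              * (\<lambda>j\<in>{1..}. ?F (subtree j (config \<omega>))) j)) + ennreal (Q [] \<omega>)"
        by (simp add: recursion_value_eq root)
      also have "(\<Sum>\<^sub>\<infinity>j\<in>children (N [] \<omega>). ennreal (snd (snd (branch_vector Q N C [] \<omega>)) j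
              * (\<lambda>j\<in>{1..}. ?F (subtree j (config \<omega>))) j))
          = (\<Sum>\<^sub>\<infinity>j\<in>children (N [] \<omega>). ennreal (snd (snd (branch_vector Q N C [] \<omega>)) j)
              * weighted_total (subtree j (config \<omega>)))"
        using elim by (intro infsum_cong)
          (auto simp: branch_vector_def ennreal_mult' dest!: children_ge_1)
      also have "\<dots> + ennreal (Q [] \<omega>) = tree_total Q N C \<omega>"
        using elim weighted_total_recursion[of "config \<omega>"] unfolding root by simp
      finally show ?case .
    qed
  qed (use measurable_compose[OF joint measurable_recursion_value] in auto)
  also have "\<dots> = distr (real_law M (tree_total Q N C)) borel ennreal"
    unfolding real_law_def
    by (subst distr_distr; (intro distr_cong_AE)?)
      (auto simp: o_def intro!: eventually_mono[OF tree_total_finite])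
  finally have "distr (real_law M (tree_total Q N C)) borel ennreal
      = recursion_law branch_law (real_law M (tree_total Q N C))" ..
  moreover have "real_distribution (real_law M (tree_total Q N C))"
    unfolding real_law_def by (rule real_distribution_distr) measurable
  moreover have "AE x in real_law M (tree_total Q N C). 0 \<le> x"
    unfolding real_law_def by (subst AE_distr_iff) auto
  ultimately show ?thesis
    by (simp add: recursion_solution_def branch_law_def)
qed

end

section \<open>Uniqueness: the recursion contracts couplings\<close>

text \<open>Independence of the coordinates is preserved by \<open>f\<close>, which identifies the image of the product also for
  an infinite index set.\<close>

lemma distr_PiM_map:
  assumes P: "prob_space P" and f [measurable]: "f \<in> measurable P S" and I: "I \<noteq> {}"
  shows "distr (\<Pi>\<^sub>M i\<in>I. P) (\<Pi>\<^sub>M i\<in>I. S) (\<lambda>r. \<lambda>i\<in>I. f (r i)) = (\<Pi>\<^sub>M i\<in>I. distr P S f)"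
proof -
  let ?P = "\<Pi>\<^sub>M i\<in>I. P"
  interpret PP: prob_space ?P by (rule prob_space_PiM) (rule P)
  have comp: "distr ?P P (\<lambda>r. r i) = P" if "i \<in> I" for i
    using that by (intro distr_PiM_component P)
  have "distr ?P ?P (\<lambda>r. \<lambda>i\<in>I. r i) = distr ?P ?P (\<lambda>r. r)"
    by (intro distr_cong) (auto simp: space_PiM)
  also have "\<dots> = (\<Pi>\<^sub>M i\<in>I. distr ?P P (\<lambda>r. r i))"
    by (simp, intro PiM_cong) (auto simp: comp)
  finally have "PP.indep_vars (\<lambda>_. P) (\<lambda>i r. r i) I"
    using I by (subst PP.indep_vars_iff_distr_eq_PiM') auto
  then have "PP.indep_vars (\<lambda>_. S) (\<lambda>i r. f (r i)) I"
    by (rule PP.indep_vars_compose2) (rule f)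
  then have "distr ?P (\<Pi>\<^sub>M i\<in>I. S) (\<lambda>r. \<lambda>i\<in>I. f (r i)) = (\<Pi>\<^sub>M i\<in>I. distr ?P S (\<lambda>r. f (r i)))"
    using I by (subst (asm) PP.indep_vars_iff_distr_eq_PiM') auto
  also have "\<dots> = (\<Pi>\<^sub>M i\<in>I. distr P S f)"
  proof (rule PiM_cong[OF refl])
    fix i assume i: "i \<in> I"
    have "distr (distr ?P P (\<lambda>r. r i)) S f = distr ?P S (\<lambda>r. f (r i))"
      using i by (subst distr_distr) (auto simp: o_def)
    then show "distr ?P S (\<lambda>r. f (r i)) = distr P S f"
      using comp[OF i] by simp
  qed
  finally show ?thesis .
qed

definition coupling :: "(real \<times> real) measure \<Rightarrow> real measure \<Rightarrow> real measure \<Rightarrow> bool" where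
  "coupling \<pi> \<mu> \<nu> \<longleftrightarrow> prob_space \<pi> \<and> sets \<pi> = sets (borel \<Otimes>\<^sub>M borel) \<and>
     distr \<pi> borel fst = \<mu> \<and> distr \<pi> borel snd = \<nu>"

text \<open>For \<open>0 < \<beta> \<le> 1\<close> the function \<open>\<bar>x - y\<bar>\<^sup>\<beta>\<close> is a metric on the reals; the infimum of this cost over
  all couplings is the Wasserstein distance of order one for that metric.\<close>

definition transport_cost :: "real \<Rightarrow> (real \<times> real) measure \<Rightarrow> ennreal" where
  "transport_cost \<beta> \<pi> = (\<integral>\<^sup>+p. ennreal (\<bar>fst p - snd p\<bar> powr \<beta>) \<partial>\<pi>)"

lemma abs_enn2real_diff_le:
  assumes "a \<le> b + d" "b \<le> a + d" "a < \<top>" "b < \<top>"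
  shows "ennreal \<bar>enn2real a - enn2real b\<bar> \<le> d"
proof (cases d)
  case (real r)
  with assms show ?thesis
    by (cases a; cases b)
      (auto simp: abs_le_iff intro!: ennreal_leI simp flip: ennreal_plus)
qed simp

locale contracting_recursion =
  fixes B :: "mark measure" and \<beta> :: real
  assumes prob_B: "prob_space B" and sets_B [measurable_cong]: "sets B = sets branch_space"
    and nonneg_B: "AE b in B. 0 \<le> fst b \<and> (\<forall>j\<ge>1. 0 \<le> snd (snd b) j)"
    and \<beta>: "0 < \<beta>" "\<beta> \<le> 1"
    and contraction:
      "(\<integral>\<^sup>+b. (\<Sum>\<^sub>\<infinity>j\<in>children (fst (snd b)). ennreal (snd (snd b) j powr \<beta>)) \<partial>B) < 1"
begin

definition \<rho> :: ennreal where
  "\<rho> = (\<integral>\<^sup>+b. (\<Sum>\<^sub>\<infinity>j\<in>children (fst (snd b)). ennreal (snd (snd b) j powr \<beta>)) \<partial>B)"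

text \<open>A one-sided estimate in \<open>[0, \<infinity>]\<close> avoids subtraction of possibly infinite values; the additive
  term \<open>Q\<close> is common to both sides.\<close>

lemma recursion_value_diff_le:
  assumes "\<forall>j\<ge>1. 0 \<le> snd (snd b) j"
  shows "recursion_value (b, x) \<le> recursion_value (b, y)
    + (\<Sum>\<^sub>\<infinity>j\<in>children (fst (snd b)). ennreal (snd (snd b) j * \<bar>x j - y j\<bar>))"
proof -
  let ?c = "snd (snd b)"
  have "ennreal (?c j * x j) \<le> ennreal (?c j * y j) + ennreal (?c j * \<bar>x j - y j\<bar>)" if "1 \<le> j" for j
  proof -
    have c: "0 \<le> ?c j" using assms that by simp
    then have "?c j * x j \<le> ?c j * (y j + \<bar>x j - y j\<bar>)"
      by (intro mult_left_mono) auto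
    then have "ennreal (?c j * x j) \<le> ennreal (?c j * y j + ?c j * \<bar>x j - y j\<bar>)"
      by (intro ennreal_leI) (simp add: distrib_left)
    also have "\<dots> \<le> ennreal (?c j * y j) + ennreal (?c j * \<bar>x j - y j\<bar>)"
      using c by (cases "0 \<le> ?c j * y j") (auto simp: ennreal_neg intro!: ennreal_leI)
    finally show ?thesis .
  qed
  then have "(\<Sum>\<^sub>\<infinity>j\<in>children (fst (snd b)). ennreal (?c j * x j))
      \<le> (\<Sum>\<^sub>\<infinity>j\<in>children (fst (snd b)). ennreal (?c j * y j) + ennreal (?c j * \<bar>x j - y j\<bar>))"
    by (rule infsum_children_mono)
  also have "\<dots> = (\<Sum>\<^sub>\<infinity>j\<in>children (fst (snd b)). ennreal (?c j * y j))
      + (\<Sum>\<^sub>\<infinity>j\<in>children (fst (snd b)). ennreal (?c j * \<bar>x j - y j\<bar>))"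
    by (intro infsum_add nonneg_summable_on_complete) auto
  finally show ?thesis
    by (simp add: recursion_value_eq add_right_mono ac_simps)
qed

text \<open>Both coordinates of \<open>\<pi>'\<close> are the right-hand side of the recursion for the same root vector, with the
  two coordinates of iid pairs of law \<open>\<pi>\<close> in place of the \<open>R\<^sub>j\<close>. The marginals are reproduced because
  \<open>\<mu>\<close> and \<open>\<nu>\<close> are solutions. The difference of the coordinates is at most
  \<open>\<Sum>\<^sub>j C\<^sub>j \<bar>x\<^sub>j - y\<^sub>j\<bar>\<close>; its \<open>\<beta>\<close>-th power is bounded by subadditivity, and the
  expectation factorises by \<open>nn_integral_offspring\<close>.\<close>

lemma coupling_step:
  assumes \<mu>: "recursion_solution B \<mu>" and \<nu>: "recursion_solution B \<nu>" and \<pi>: "coupling \<pi> \<mu> \<nu>"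
  obtains \<pi>' where "coupling \<pi>' \<mu> \<nu>" "transport_cost \<beta> \<pi>' \<le> \<rho> * transport_cost \<beta> \<pi>"
proof -
  interpret B: prob_space B by (rule prob_B)
  interpret \<pi>: prob_space \<pi> using \<pi> by (simp add: coupling_def)
  have sets_\<pi> [measurable_cong]: "sets \<pi> = sets (borel \<Otimes>\<^sub>M borel)"
    and fst_\<pi>: "distr \<pi> borel fst = \<mu>" and snd_\<pi>: "distr \<pi> borel snd = \<nu>"
    using \<pi> by (simp_all add: coupling_def)
  let ?PP = "\<Pi>\<^sub>M j\<in>{1::nat..}. \<pi>"
  let ?R = "\<Pi>\<^sub>M j\<in>{1::nat..}. (borel :: real measure)"
  interpret PP: prob_space ?PP by (rule prob_space_PiM) (rule \<pi>.prob_space_axioms)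
  let ?P = "B \<Otimes>\<^sub>M ?PP"
  interpret P: pair_prob_space B ?PP ..
  \<comment> \<open>\<open>X fst\<close> and \<open>X snd\<close> are the two coupled right-hand sides; both coordinates are handled at once.\<close>
  define X where "X f x = recursion_value (fst x, \<lambda>j\<in>{1..}. f (snd x j))"
    for f :: "real \<times> real \<Rightarrow> real" and x :: "mark \<times> (nat \<Rightarrow> real \<times> real)"
  have map_meas: "(\<lambda>(b, r). (b, \<lambda>j\<in>{1..}. f (r j))) \<in> measurable ?P (branch_space \<Otimes>\<^sub>M ?R)"
    if [measurable]: "f \<in> borel_measurable (borel \<Otimes>\<^sub>M borel)" for f
    by measurable
  have X_meas [measurable]: "X f \<in> borel_measurable ?P"
    if "f \<in> borel_measurable (borel \<Otimes>\<^sub>M borel)" for f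
    using measurable_compose[OF map_meas[OF that] measurable_recursion_value]
    by (simp add: X_def[abs_def] case_prod_beta)
  have X_law: "distr ?P borel (X f) = distr \<eta> borel ennreal"
    if f [measurable]: "f \<in> borel_measurable (borel \<Otimes>\<^sub>M borel)" and \<eta>: "distr \<pi> borel f = \<eta>"
      "recursion_solution B \<eta>" for f \<eta>
  proof -
    have "distr ?P (branch_space \<Otimes>\<^sub>M ?R) (\<lambda>(b, r). (b, \<lambda>j\<in>{1..}. f (r j)))
        = distr B branch_space (\<lambda>b. b) \<Otimes>\<^sub>M distr ?PP ?R (\<lambda>r. \<lambda>j\<in>{1..}. f (r j))"
      by (rule pair_measure_distr[symmetric])
        (measurable, intro prob_space_imp_sigma_finite PP.prob_space_distr, measurable)
    also have "\<dots> = B \<Otimes>\<^sub>M (\<Pi>\<^sub>M j\<in>{1..}. \<eta>)"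
      using \<eta> sets_B by (subst distr_PiM_map) (auto simp: \<pi>.prob_space_axioms distr_id2)
    finally have "recursion_law B \<eta> = distr (distr ?P (branch_space \<Otimes>\<^sub>M ?R)
        (\<lambda>(b, r). (b, \<lambda>j\<in>{1..}. f (r j)))) borel recursion_value"
      by (simp add: recursion_law_def)
    also have "\<dots> = distr ?P borel (X f)"
      by (subst distr_distr[OF measurable_recursion_value map_meas[OF f]])
        (simp add: o_def X_def[abs_def] case_prod_beta)
    finally show ?thesis
      using \<eta> by (simp add: recursion_solution_def)
  qed
  have X_finite: "AE x in ?P. X f x < \<top>"
    if f [measurable]: "f \<in> borel_measurable (borel \<Otimes>\<^sub>M borel)" and \<eta>: "distr \<pi> borel f = \<eta>"
      "recursion_solution B \<eta>" for f \<eta>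
  proof -
    have "sets \<eta> = sets borel"
      using \<eta>(2) by (auto simp: recursion_solution_def real_distribution_def real_distribution_axioms_def)
    then have "AE y in distr ?P borel (X f). y < \<top>"
      unfolding X_law[OF that] by (subst AE_distr_iff) (auto cong: measurable_cong_sets)
    then show ?thesis by (rule AE_distrD[rotated]) measurable
  qed
  define \<pi>' where "\<pi>' = distr ?P (borel \<Otimes>\<^sub>M borel) (\<lambda>x. (enn2real (X fst x), enn2real (X snd x)))"
  have marginal: "distr ?P borel (\<lambda>x. enn2real (X f x)) = \<eta>"
    if f [measurable]: "f \<in> borel_measurable (borel \<Otimes>\<^sub>M borel)" and \<eta>: "distr \<pi> borel f = \<eta>"
      "recursion_solution B \<eta>" for f \<eta>
  proof -
    have sets: "sets \<eta> = sets borel" and nonneg: "AE x in \<eta>. 0 \<le> x"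
      using \<eta>(2) by (auto simp: recursion_solution_def real_distribution_def real_distribution_axioms_def)
    note [measurable_cong] = sets
    have "distr ?P borel (\<lambda>x. enn2real (X f x)) = distr (distr ?P borel (X f)) borel enn2real"
      by (subst distr_distr) (measurable, simp add: o_def)
    also have "\<dots> = distr \<eta> borel (\<lambda>x. enn2real (ennreal x))"
      unfolding X_law[OF that] by (subst distr_distr) (auto simp: o_def cong: measurable_cong_sets)
    also have "\<dots> = distr \<eta> borel (\<lambda>x. x)"
      using nonneg by (intro distr_cong_AE) (auto cong: measurable_cong_sets)
    also have "\<dots> = \<eta>" by (rule distr_id2) (simp add: sets)
    finally show ?thesis .
  qed
  have "coupling \<pi>' \<mu> \<nu>"
    unfolding coupling_def
  proof (intro conjI)
    show "prob_space \<pi>'" unfolding \<pi>'_def by (rule P.prob_space_distr) measurable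
    show "sets \<pi>' = sets (borel \<Otimes>\<^sub>M borel)" by (simp add: \<pi>'_def)
    show "distr \<pi>' borel fst = \<mu>"
      unfolding \<pi>'_def using marginal[OF measurable_fst fst_\<pi> \<mu>]
      by (subst distr_distr) (measurable, simp add: o_def)
    show "distr \<pi>' borel snd = \<nu>"
      unfolding \<pi>'_def using marginal[OF measurable_snd snd_\<pi> \<nu>]
      by (subst distr_distr) (measurable, simp add: o_def)
  qed
  moreover have "transport_cost \<beta> \<pi>' \<le> \<rho> * transport_cost \<beta> \<pi>"
  proof -
    let ?d = "\<lambda>p :: real \<times> real. ennreal (\<bar>fst p - snd p\<bar> powr \<beta>)"
    have pair: "(\<lambda>x. (enn2real (X fst x), enn2real (X snd x))) \<in> measurable ?P (borel \<Otimes>\<^sub>M borel)"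
      by measurable
    have d: "?d \<in> borel_measurable (borel \<Otimes>\<^sub>M borel)"
      by measurable
    have "AE b in distr ?P B fst. \<forall>j\<ge>1. 0 \<le> snd (snd b) j"
      using nonneg_B by (subst PP.distr_pair_fst) auto
    then have nonneg: "AE x in ?P. \<forall>j\<ge>1. 0 \<le> snd (snd (fst x)) j"
      by (rule AE_distrD[rotated]) measurable
    have "transport_cost \<beta> \<pi>' = (\<integral>\<^sup>+x. ennreal (\<bar>enn2real (X fst x) - enn2real (X snd x)\<bar> powr \<beta>) \<partial>?P)"
      unfolding transport_cost_def \<pi>'_def 
      using d by (subst nn_integral_distr[OF pair]) simp_all
    also have "\<dots> \<le> (\<integral>\<^sup>+x. (case x of (b, r) \<Rightarrow> \<Sum>\<^sub>\<infinity>j\<in>children (fst (snd b)).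
        ennreal (snd (snd b) j powr \<beta>) * ?d (r j)) \<partial>?P)"
    proof (rule nn_integral_mono_AE)
      show "AE x in ?P. ennreal (\<bar>enn2real (X fst x) - enn2real (X snd x)\<bar> powr \<beta>)
          \<le> (case x of (b, r) \<Rightarrow> \<Sum>\<^sub>\<infinity>j\<in>children (fst (snd b)).
            ennreal (snd (snd b) j powr \<beta>) * ?d (r j))"
        using nonneg X_finite[OF measurable_fst fst_\<pi> \<mu>] X_finite[OF measurable_snd snd_\<pi> \<nu>]
      proof eventually_elim
        case (elim x)
        obtain b r where x: "x = (b, r)" by (cases x)
        let ?c = "snd (snd b)"
        let ?D = "\<Sum>\<^sub>\<infinity>j\<in>children (fst (snd b)). ennreal (?c j * \<bar>fst (r j) - snd (r j)\<bar>)"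
        have c: "\<forall>j\<ge>1. 0 \<le> ?c j" using elim x by simp
        have D1: "(\<Sum>\<^sub>\<infinity>j\<in>children (fst (snd b)).
            ennreal (?c j * \<bar>(\<lambda>j\<in>{1..}. fst (r j)) j - (\<lambda>j\<in>{1..}. snd (r j)) j\<bar>)) = ?D"
          by (intro infsum_cong) (auto dest: children_ge_1)
        have D2: "(\<Sum>\<^sub>\<infinity>j\<in>children (fst (snd b)).
            ennreal (?c j * \<bar>(\<lambda>j\<in>{1..}. snd (r j)) j - (\<lambda>j\<in>{1..}. fst (r j)) j\<bar>)) = ?D"
          by (intro infsum_cong) (auto dest!: children_ge_1 simp: abs_minus_commute)
        have "X fst x \<le> X snd x + ?D" "X snd x \<le> X fst x + ?D"
          using recursion_value_diff_le[OF c, of "\<lambda>j\<in>{1..}. fst (r j)" "\<lambda>j\<in>{1..}. snd (r j)"]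
            recursion_value_diff_le[OF c, of "\<lambda>j\<in>{1..}. snd (r j)" "\<lambda>j\<in>{1..}. fst (r j)"]
          unfolding D1 D2 by (simp_all add: X_def x)
        then have "ennreal \<bar>enn2real (X fst x) - enn2real (X snd x)\<bar> \<le> ?D"
          using elim by (intro abs_enn2real_diff_le) auto
        then have "ennreal_powr \<beta> (ennreal \<bar>enn2real (X fst x) - enn2real (X snd x)\<bar>) \<le> ennreal_powr \<beta> ?D"
          by (rule ennreal_powr_mono[OF \<beta>(1)])
        also have "\<dots> \<le> (\<Sum>\<^sub>\<infinity>j\<in>children (fst (snd b)).
            ennreal_powr \<beta> (ennreal (?c j * \<bar>fst (r j) - snd (r j)\<bar>)))"
          by (rule ennreal_powr_infsum_children_le[OF \<beta>])
        also have "\<dots> \<le> (\<Sum>\<^sub>\<infinity>j\<in>children (fst (snd b)). ennreal (?c j powr \<beta>) * ?d (r j))"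
          using c by (intro infsum_children_mono)
            (simp add: ennreal_powr_ennreal powr_mult flip: ennreal_mult)
        finally show ?case by (simp add: ennreal_powr_ennreal x)
      qed
    qed
    also have "\<dots> = \<rho> * transport_cost \<beta> \<pi>"
      unfolding \<rho>_def transport_cost_def
    proof (rule nn_integral_offspring[OF prob_B sets_B \<pi>.prob_space_axioms])
      show "(\<lambda>b. ennreal (snd (snd b) j powr \<beta>)) \<in> borel_measurable branch_space" if "1 \<le> j" for j
        using measurable_mark_factor[OF that] by measurable
    qed measurable
    finally show ?thesis .
  qed
  ultimately show ?thesis by (rule that)
qed

text \<open>The product coupling has finite cost since \<open>\<bar>x - y\<bar>\<^sup>\<beta> \<le> x\<^sup>\<beta> + y\<^sup>\<beta>\<close> for nonnegative \<open>x\<close> and \<open>y\<close>.\<close>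

lemma finite_cost_coupling:
  assumes \<mu>: "recursion_solution B \<mu>" "(\<integral>\<^sup>+x. ennreal (x powr \<beta>) \<partial>\<mu>) < \<infinity>"
    and \<nu>: "recursion_solution B \<nu>" "(\<integral>\<^sup>+x. ennreal (x powr \<beta>) \<partial>\<nu>) < \<infinity>"
  shows "coupling (\<mu> \<Otimes>\<^sub>M \<nu>) \<mu> \<nu>" "transport_cost \<beta> (\<mu> \<Otimes>\<^sub>M \<nu>) < \<infinity>"
proof -
  interpret \<mu>: real_distribution \<mu> using \<mu> by (simp add: recursion_solution_def)
  interpret \<nu>: real_distribution \<nu> using \<nu> by (simp add: recursion_solution_def)
  interpret P: pair_prob_space \<mu> \<nu> ..
  have marg1: "distr (\<mu> \<Otimes>\<^sub>M \<nu>) borel fst = \<mu>"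
    using \<nu>.distr_pair_fst[of \<mu>] by (simp cong: distr_cong)
  have marg2: "distr (\<mu> \<Otimes>\<^sub>M \<nu>) borel snd = \<nu>"
  proof (rule measure_eqI)
    fix A assume "A \<in> sets (distr (\<mu> \<Otimes>\<^sub>M \<nu>) borel snd)"
    then have A: "A \<in> sets borel" by simp
    have "snd -` A \<inter> space (\<mu> \<Otimes>\<^sub>M \<nu>) = space \<mu> \<times> A"
      by (auto simp: space_pair_measure)
    then have "emeasure (distr (\<mu> \<Otimes>\<^sub>M \<nu>) borel snd) A = emeasure (\<mu> \<Otimes>\<^sub>M \<nu>) (space \<mu> \<times> A)"
      using A by (subst emeasure_distr) (simp_all only:, measurable)
    also have "\<dots> = emeasure \<mu> (space \<mu>) * emeasure \<nu> A"
      by (rule \<nu>.emeasure_pair_measure_Times) (use A in simp_all)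
    also have "\<dots> = emeasure \<nu> A"
      by (simp only: \<mu>.emeasure_space_1 mult_1)
    finally show "emeasure (distr (\<mu> \<Otimes>\<^sub>M \<nu>) borel snd) A = emeasure \<nu> A" .
  qed simp
  show "coupling (\<mu> \<Otimes>\<^sub>M \<nu>) \<mu> \<nu>"
    unfolding coupling_def
    by (intro conjI P.prob_space_axioms marg1 marg2) (auto intro: sets_pair_measure_cong)
  have "AE x in distr (\<mu> \<Otimes>\<^sub>M \<nu>) borel fst. 0 \<le> x" "AE x in distr (\<mu> \<Otimes>\<^sub>M \<nu>) borel snd. 0 \<le> x"
    using \<mu> \<nu> unfolding marg1 marg2 by (simp_all add: recursion_solution_def)
  then have "AE p in \<mu> \<Otimes>\<^sub>M \<nu>. 0 \<le> fst p" "AE p in \<mu> \<Otimes>\<^sub>M \<nu>. 0 \<le> snd p"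
    by (auto intro: AE_distrD[rotated])
  then have "transport_cost \<beta> (\<mu> \<Otimes>\<^sub>M \<nu>)
      \<le> (\<integral>\<^sup>+p. ennreal (fst p powr \<beta>) + ennreal (snd p powr \<beta>) \<partial>(\<mu> \<Otimes>\<^sub>M \<nu>))"
    unfolding transport_cost_def
  proof (intro nn_integral_mono_AE, eventually_elim)
    case (elim p)
    have "\<bar>fst p - snd p\<bar> powr \<beta> \<le> (fst p + snd p) powr \<beta>"
      using elim \<beta> by (intro powr_mono2) auto
    also have "\<dots> \<le> fst p powr \<beta> + snd p powr \<beta>"
      using elim \<beta> by (intro powr_add_le)
    finally show ?case by (simp flip: ennreal_plus add: ennreal_leI)
  qed
  also have "\<dots> = (\<integral>\<^sup>+p. ennreal (fst p powr \<beta>) \<partial>(\<mu> \<Otimes>\<^sub>M \<nu>)) + (\<integral>\<^sup>+p. ennreal (snd p powr \<beta>) \<partial>(\<mu> \<Otimes>\<^sub>M \<nu>))"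
    by (rule nn_integral_add) measurable
  also have "(\<integral>\<^sup>+p. ennreal (fst p powr \<beta>) \<partial>(\<mu> \<Otimes>\<^sub>M \<nu>))
      = (\<integral>\<^sup>+x. ennreal (x powr \<beta>) \<partial>distr (\<mu> \<Otimes>\<^sub>M \<nu>) borel fst)"
    by (rule nn_integral_distr[symmetric]) measurable
  also have "(\<integral>\<^sup>+p. ennreal (snd p powr \<beta>) \<partial>(\<mu> \<Otimes>\<^sub>M \<nu>))
      = (\<integral>\<^sup>+x. ennreal (x powr \<beta>) \<partial>distr (\<mu> \<Otimes>\<^sub>M \<nu>) borel snd)"
    by (rule nn_integral_distr[symmetric]) measurable
  finally show "transport_cost \<beta> (\<mu> \<Otimes>\<^sub>M \<nu>) < \<infinity>"
    unfolding marg1 marg2 using \<mu> \<nu> by (auto elim!: le_less_trans)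
qed

lemma contracting_couplings:
  assumes \<mu>: "recursion_solution B \<mu>" and \<nu>: "recursion_solution B \<nu>" and \<pi>: "coupling \<pi> \<mu> \<nu>"
  shows "\<exists>\<pi>'. coupling \<pi>' \<mu> \<nu> \<and> transport_cost \<beta> \<pi>' \<le> \<rho> ^ n * transport_cost \<beta> \<pi>"
proof (induction n)
  case 0
  show ?case using \<pi> by auto
next
  case (Suc n)
  then obtain \<pi>1 where \<pi>1: "coupling \<pi>1 \<mu> \<nu>" "transport_cost \<beta> \<pi>1 \<le> \<rho> ^ n * transport_cost \<beta> \<pi>"
    by blast
  obtain \<pi>2 where \<pi>2: "coupling \<pi>2 \<mu> \<nu>" "transport_cost \<beta> \<pi>2 \<le> \<rho> * transport_cost \<beta> \<pi>1"
    by (rule coupling_step[OF \<mu> \<nu> \<pi>1(1)])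
  have "transport_cost \<beta> \<pi>2 \<le> \<rho> * (\<rho> ^ n * transport_cost \<beta> \<pi>)"
    using \<pi>2(2) by (rule order_trans) (intro mult_left_mono \<pi>1, simp)
  then show ?case using \<pi>2(1) by (auto simp: mult.assoc)
qed

text \<open>If \<open>fst p \<le> x\<close>, then either \<open>snd p \<le> x + e\<close> or the coordinates are at least \<open>e\<close> apart; the latter
  has small probability by the Markov inequality.\<close>

lemma atMost_le_of_coupling:
  assumes \<pi>: "coupling \<pi> \<mu> \<nu>" and e: "0 < e"
  shows "emeasure \<mu> {..x} \<le> emeasure \<nu> {..x + e} + ennreal (1 / e powr \<beta>) * transport_cost \<beta> \<pi>"
proof -
  interpret \<pi>: prob_space \<pi> using \<pi> by (simp add: coupling_def)
  have sets_\<pi> [measurable_cong]: "sets \<pi> = sets (borel \<Otimes>\<^sub>M borel)"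
    and fst_\<pi>: "distr \<pi> borel fst = \<mu>" and snd_\<pi>: "distr \<pi> borel snd = \<nu>"
    using \<pi> by (simp_all add: coupling_def)
  let ?d = "\<lambda>p :: real \<times> real. ennreal (\<bar>fst p - snd p\<bar> powr \<beta>)"
  let ?far = "{p \<in> space \<pi>. 1 \<le> ennreal (1 / e powr \<beta>) * ?d p}"
  have far: "p \<in> ?far" if "p \<in> space \<pi>" "e \<le> \<bar>fst p - snd p\<bar>" for p
  proof -
    have "e powr \<beta> \<le> \<bar>fst p - snd p\<bar> powr \<beta>"
      using that e \<beta> by (intro powr_mono2) auto
    then have "1 \<le> 1 / e powr \<beta> * \<bar>fst p - snd p\<bar> powr \<beta>"
      using e by simp
    then show ?thesis
      using that by (simp flip: ennreal_mult ennreal_1)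
  qed
  have "emeasure \<mu> {..x} = emeasure \<pi> {p \<in> space \<pi>. fst p \<le> x}"
    unfolding fst_\<pi>[symmetric] by (subst emeasure_distr) (auto intro!: arg_cong[where f = "emeasure \<pi>"])
  also have "\<dots> \<le> emeasure \<pi> ({p \<in> space \<pi>. snd p \<le> x + e} \<union> ?far)"
  proof (rule emeasure_mono)
    show "{p \<in> space \<pi>. fst p \<le> x} \<subseteq> {p \<in> space \<pi>. snd p \<le> x + e} \<union> ?far"
    proof
      fix p assume p: "p \<in> {p \<in> space \<pi>. fst p \<le> x}"
      show "p \<in> {p \<in> space \<pi>. snd p \<le> x + e} \<union> ?far"
        using p far[of p] by (cases "snd p \<le> x + e") auto
    qed
  qed measurable
  also have "\<dots> \<le> emeasure \<pi> {p \<in> space \<pi>. snd p \<le> x + e} + emeasure \<pi> ?far"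
    by (rule emeasure_subadditive) measurable
  also have "emeasure \<pi> {p \<in> space \<pi>. snd p \<le> x + e} = emeasure \<nu> {..x + e}"
    unfolding snd_\<pi>[symmetric] by (subst emeasure_distr) (auto intro!: arg_cong[where f = "emeasure \<pi>"])
  also have "emeasure \<pi> ?far \<le> ennreal (1 / e powr \<beta>) * transport_cost \<beta> \<pi>"
    unfolding transport_cost_def
    using nn_integral_Markov_inequality[of ?d "space \<pi>" \<pi> "ennreal (1 / e powr \<beta>)"]
    by (simp cong: nn_integral_cong)
  finally show ?thesis by (simp add: add_left_mono)
qed

text \<open>The cost of the couplings tends to \<open>0\<close> for every fixed gap \<open>y - x\<close>; then the gap is closed by right
  continuity of the distribution function.\<close>

lemma solution_cdf_le:
  assumes \<mu>: "recursion_solution B \<mu>" "(\<integral>\<^sup>+x. ennreal (x powr \<beta>) \<partial>\<mu>) < \<infinity>"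
    and \<nu>: "recursion_solution B \<nu>" "(\<integral>\<^sup>+x. ennreal (x powr \<beta>) \<partial>\<nu>) < \<infinity>"
  shows "cdf \<mu> x \<le> cdf \<nu> x"
proof -
  interpret \<mu>: real_distribution \<mu> using \<mu> by (simp add: recursion_solution_def)
  interpret \<nu>: real_distribution \<nu> using \<nu> by (simp add: recursion_solution_def)
  define c where "c = transport_cost \<beta> (\<mu> \<Otimes>\<^sub>M \<nu>)"
  have c: "c < \<infinity>" unfolding c_def by (rule finite_cost_coupling[OF \<mu> \<nu>])
  have "cdf \<mu> x \<le> cdf \<nu> y" if "x < y" for y
  proof -
    define k where "k = ennreal (1 / (y - x) powr \<beta>) * c"
    have k: "k < \<top>" using c by (simp add: k_def ennreal_mult_less_top)
    have bound: "emeasure \<mu> {..x} \<le> emeasure \<nu> {..y} + \<rho> ^ n * k" for n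
    proof -
      obtain \<pi> where \<pi>: "coupling \<pi> \<mu> \<nu>" "transport_cost \<beta> \<pi> \<le> \<rho> ^ n * c"
        using contracting_couplings[OF \<mu>(1) \<nu>(1) finite_cost_coupling(1)[OF \<mu> \<nu>]]
        unfolding c_def by blast
      have "emeasure \<mu> {..x} \<le> emeasure \<nu> {..y}
          + ennreal (1 / (y - x) powr \<beta>) * transport_cost \<beta> \<pi>"
        using atMost_le_of_coupling[OF \<pi>(1), of "y - x" x] that by simp
      also have "\<dots> \<le> emeasure \<nu> {..y} + ennreal (1 / (y - x) powr \<beta>) * (\<rho> ^ n * c)"
        by (intro add_left_mono mult_left_mono \<pi>) simp
      finally show ?thesis by (simp add: k_def ac_simps)
    qed
    have "(\<Sum>n. \<rho> ^ n * k) < \<top>"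
      using ennreal_geometric_less_top[OF contraction] k
      by (simp add: \<rho>_def ennreal_mult_less_top)
    then have "(\<lambda>n. \<rho> ^ n * k) \<longlonglongrightarrow> 0"
      by (rule ennreal_terms_tendsto_0)
    then have "(\<lambda>n. emeasure \<nu> {..y} + \<rho> ^ n * k) \<longlonglongrightarrow> emeasure \<nu> {..y} + 0"
      by (intro tendsto_add tendsto_const)
    then have "emeasure \<mu> {..x} \<le> emeasure \<nu> {..y}"
      using bound by (simp add: LIMSEQ_le_const)
    then show ?thesis
      by (simp add: cdf_def \<mu>.emeasure_eq_measure \<nu>.emeasure_eq_measure)
  qed
  moreover have "(cdf \<nu> \<longlongrightarrow> cdf \<nu> x) (at_right x)"
    using \<nu>.cdf_is_right_cont[of x] by (simp add: continuous_within)
  ultimately show ?thesis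
    by (intro tendsto_lowerbound[of "cdf \<nu>" "cdf \<nu> x" "at_right x"])
      (auto simp: eventually_at_right_less intro: eventually_mono[OF eventually_at_right_less])
qed

lemma solution_unique:
  assumes \<mu>: "recursion_solution B \<mu>" "(\<integral>\<^sup>+x. ennreal (x powr \<beta>) \<partial>\<mu>) < \<infinity>"
    and \<nu>: "recursion_solution B \<nu>" "(\<integral>\<^sup>+x. ennreal (x powr \<beta>) \<partial>\<nu>) < \<infinity>"
  shows "\<mu> = \<nu>"
proof (rule cdf_unique)
  show "real_distribution \<mu>" "real_distribution \<nu>"
    using \<mu> \<nu> by (simp_all add: recursion_solution_def)
  show "cdf \<mu> = cdf \<nu>"
    by (intro ext antisym solution_cdf_le assms)
qed

end

section \<open>Initial values as marks of a tree\<close>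

text \<open>The pair of \<open>R0 i\<close> and the remaining components \<open>(N, C)\<close> of the branching vector is again iid over the
  nodes. Independence between nodes is checked on measurable rectangles, which are stable under
  intersection and generate the product sigma-algebra: there the probability factorises first between
  the initial values and the tree, and then within each of the two families.\<close>

lemma (in weighted_branching_tree_init) tree_of_initial_values: "weighted_branching_tree M R0 N C"
proof (intro weighted_branching_tree.intro prob_space_axioms weighted_branching_tree_axioms.intro)
  let ?V = "branch_vector Q N C" and ?W = "branch_vector R0 N C"
  let ?TS = "count_space (UNIV :: enat set) \<Otimes>\<^sub>M (\<Pi>\<^sub>M j\<in>{1::nat..}. (borel :: real measure))"
  let ?AR = "vimage_algebra (space M) (\<lambda>\<omega>. \<lambda>i\<in>tree_index. R0 i \<omega>) (\<Pi>\<^sub>M i\<in>tree_index. borel)"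
  let ?AV = "vimage_algebra (space M) (\<lambda>\<omega>. \<lambda>i\<in>tree_index. ?V i \<omega>) (\<Pi>\<^sub>M i\<in>tree_index. branch_space)"
  have R0_indep: "indep_vars (\<lambda>_. borel) R0 tree_index"
    and R0_law: "\<And>i j. i \<in> tree_index \<Longrightarrow> j \<in> tree_index \<Longrightarrow> distr M borel (R0 i) = distr M borel (R0 j)"
    using iid_init unfolding iid_vars_def by blast+
  have R0: "R0 i \<in> borel_measurable M" if "i \<in> tree_index" for i
    using R0_indep that by (simp add: indep_vars_def)
  define T where "T i \<omega> = snd (?V i \<omega>)" for i \<omega>
  have T_meas: "T i \<in> measurable M ?TS" if "i \<in> tree_index" for i
    using measurable_compose[OF measurable_branch[OF that], of snd ?TS]
    by (simp add: T_def[abs_def] branch_space_def)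
  have T_indep: "indep_vars (\<lambda>_. ?TS) T tree_index"
    unfolding T_def[abs_def] by (rule indep_vars_compose2[OF indep_branch]) (simp add: branch_space_def)
  have W: "?W i \<omega> = (R0 i \<omega>, T i \<omega>)" for i \<omega>
    by (simp add: T_def branch_vector_def)
  have W_meas: "?W i \<in> measurable M branch_space" if "i \<in> tree_index" for i
    using measurable_Pair[OF R0[OF that] T_meas[OF that]] by (simp add: W[abs_def] branch_space_def)
  have in_AR: "R0 i -` A \<inter> space M \<in> sets ?AR" if i: "i \<in> tree_index" and A: "A \<in> sets borel" for i A
  proof -
    have "(\<lambda>\<omega>. \<lambda>i\<in>tree_index. R0 i \<omega>) \<in> measurable ?AR (\<Pi>\<^sub>M i\<in>tree_index. borel)"
      by (rule measurable_vimage_algebra1) (auto simp: space_PiM)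
    from measurable_compose[OF this measurable_component_singleton[OF i]]
    have "R0 i \<in> measurable ?AR borel" using i by simp
    from measurable_sets[OF this A] show ?thesis by simp
  qed
  have in_AV: "T i -` A \<inter> space M \<in> sets ?AV" if i: "i \<in> tree_index" and A: "A \<in> sets ?TS" for i A
  proof -
    have "(\<lambda>\<omega>. \<lambda>i\<in>tree_index. ?V i \<omega>) \<in> measurable ?AV (\<Pi>\<^sub>M i\<in>tree_index. branch_space)"
      using measurable_space[OF measurable_branch]
      by (intro measurable_vimage_algebra1) (auto simp: space_PiM)
    from measurable_compose[OF this measurable_component_singleton[OF i]]
    have "?V i \<in> measurable ?AV branch_space" using i by simp
    from measurable_compose[OF this, of snd ?TS] have "T i \<in> measurable ?AV ?TS"
      by (simp add: T_def[abs_def] branch_space_def)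
    from measurable_sets[OF this A] show ?thesis by simp
  qed
  \<comment> \<open>Preimages of measurable rectangles \<open>fst p \<times> snd p\<close> under \<open>(R0 i, T i)\<close>.\<close>
  define cell where "cell i p = (R0 i -` fst p \<inter> space M) \<inter> (T i -` snd p \<inter> space M)" for i p
  define rect where "rect i = cell i ` (sets borel \<times> sets ?TS)" for i
  have "indep_sets rect tree_index"
  proof (rule indep_setsI)
    show "rect i \<subseteq> events" if "i \<in> tree_index" for i
      using measurable_sets[OF R0[OF that]] measurable_sets[OF T_meas[OF that]]
      by (auto simp: rect_def cell_def)
    fix E and J assume J: "J \<noteq> {}" "J \<subseteq> tree_index" "finite J" and E: "\<forall>j\<in>J. E j \<in> rect j"
    have "\<forall>j\<in>J. \<exists>p. p \<in> sets borel \<times> sets ?TS \<and> E j = cell j p"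
    proof
      fix j assume "j \<in> J"
      with E have "E j \<in> rect j" by (rule bspec)
      then show "\<exists>p. p \<in> sets borel \<times> sets ?TS \<and> E j = cell j p"
        unfolding rect_def by (rule imageE) (intro exI conjI)
    qed
    from bchoice[OF this] obtain p
      where p: "\<forall>j\<in>J. p j \<in> sets borel \<times> sets ?TS \<and> E j = cell j (p j)" ..
    define A A' where "A j = fst (p j)" and "A' j = snd (p j)" for j
    have A: "A j \<in> sets borel" "A' j \<in> sets ?TS"
      and E_eq: "E j = (R0 j -` A j \<inter> space M) \<inter> (T j -` A' j \<inter> space M)" if "j \<in> J" for j
      using bspec[OF p that] by (simp_all add: A_def A'_def cell_def mem_Times_iff)
    let ?r = "\<lambda>j. R0 j -` A j \<inter> space M" and ?t = "\<lambda>j. T j -` A' j \<inter> space M"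
    have J': "j \<in> tree_index" if "j \<in> J" for j
      using J(2) that by (rule subsetD)
    have "(\<Inter>j\<in>J. ?r j) \<in> sets ?AR"
      by (rule sets.finite_INT[OF J(3,1)]) (rule in_AR[OF J' A(1)])
    moreover have "(\<Inter>j\<in>J. ?t j) \<in> sets ?AV"
      by (rule sets.finite_INT[OF J(3,1)]) (rule in_AV[OF J' A(2)])
    ultimately have joint:
      "prob ((\<Inter>j\<in>J. ?r j) \<inter> (\<Inter>j\<in>J. ?t j)) = prob (\<Inter>j\<in>J. ?r j) * prob (\<Inter>j\<in>J. ?t j)"
      by (rule indep_setD[OF indep_init])
    have "(\<Inter>j\<in>J. E j) = (\<Inter>j\<in>J. ?r j \<inter> ?t j)"
      by (rule INF_cong[OF refl]) (rule E_eq)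
    also have "\<dots> = (\<Inter>j\<in>J. ?r j) \<inter> (\<Inter>j\<in>J. ?t j)"
      by (rule INF_inf_distrib[symmetric])
    finally have "prob (\<Inter>j\<in>J. E j) = prob (\<Inter>j\<in>J. ?r j) * prob (\<Inter>j\<in>J. ?t j)"
      by (simp only: joint)
    also have "prob (\<Inter>j\<in>J. ?r j) = (\<Prod>j\<in>J. prob (?r j))"
      by (rule indep_varsD[OF R0_indep J(1,3,2)]) (intro ballI A)
    also have "prob (\<Inter>j\<in>J. ?t j) = (\<Prod>j\<in>J. prob (?t j))"
      by (rule indep_varsD[OF T_indep J(1,3,2)]) (intro ballI A)
    also have "(\<Prod>j\<in>J. prob (?r j)) * (\<Prod>j\<in>J. prob (?t j)) = (\<Prod>j\<in>J. prob (E j))"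
    proof -
      have "prob (E j) = prob (?r j) * prob (?t j)" if "j \<in> J" for j
        unfolding E_eq[OF that]
        by (rule indep_setD[OF indep_init in_AR[OF J'[OF that] A(1)[OF that]] in_AV[OF J'[OF that] A(2)[OF that]]])
      then show ?thesis by (simp only: prod.distrib cong: prod.cong)
    qed
    finally show "prob (\<Inter>j\<in>J. E j) = (\<Prod>j\<in>J. prob (E j))" .
  qed
  moreover have "Int_stable (rect i)" for i
  proof (rule Int_stableI)
    fix a b assume "a \<in> rect i" "b \<in> rect i"
    then obtain p q where p: "p \<in> sets borel \<times> sets ?TS" "a = cell i p"
      and q: "q \<in> sets borel \<times> sets ?TS" "b = cell i q"
      unfolding rect_def by (elim imageE)
    have "a \<inter> b = cell i (fst p \<inter> fst q, snd p \<inter> snd q)"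
      unfolding p q cell_def by auto
    moreover have "(fst p \<inter> fst q, snd p \<inter> snd q) \<in> sets borel \<times> sets ?TS"
      using p q by (simp add: mem_Times_iff sets.Int)
    ultimately show "a \<inter> b \<in> rect i"
      unfolding rect_def by (rule image_eqI)
  qed
  ultimately have indep: "indep_sets (\<lambda>i. sigma_sets (space M) (rect i)) tree_index"
    by (rule indep_sets_sigma)
  have W_indep: "indep_vars (\<lambda>_. branch_space) ?W tree_index"
    unfolding indep_vars_def2
  proof (intro conjI ballI W_meas indep_sets_mono_sets[OF indep])
    fix i assume i: "i \<in> tree_index"
    let ?\<Omega> = "space (borel :: real measure) \<times> space ?TS"
    let ?G = "{A \<times> A' | A A'. A \<in> sets (borel :: real measure) \<and> A' \<in> sets ?TS}"
    have "?W i \<in> space M \<rightarrow> ?\<Omega>"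
      using measurable_space[OF W_meas[OF i]] by (auto simp: branch_space_def space_pair_measure)
    from sigma_sets_vimage_commute[OF this, of ?G]
    have "{?W i -` A \<inter> space M | A. A \<in> sets branch_space}
        = sigma_sets (space M) {?W i -` A \<inter> space M | A. A \<in> ?G}"
      unfolding branch_space_def by (simp only: sets_pair_measure)
    moreover have "{?W i -` A \<inter> space M | A. A \<in> ?G} \<subseteq> rect i"
    proof clarify
      fix A :: "real set" and A' :: "(enat \<times> (nat \<Rightarrow> real)) set"
      assume "A \<in> sets borel" "A' \<in> sets ?TS"
      then have "(A, A') \<in> sets borel \<times> sets ?TS" by simp
      moreover have "?W i -` (A \<times> A') \<inter> space M = cell i (A, A')"
        by (auto simp: W cell_def)
      ultimately show "?W i -` (A \<times> A') \<inter> space M \<in> rect i"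
        unfolding rect_def by (rule rev_image_eqI)
    qed
    ultimately show "{?W i -` A \<inter> space M | A. A \<in> sets branch_space} \<subseteq> sigma_sets (space M) (rect i)"
      by (simp only: sigma_sets_mono')
  qed
  have W_law: "distr M branch_space (?W i) = distr M borel (R0 i) \<Otimes>\<^sub>M distr M ?TS (T i)"
    if i: "i \<in> tree_index" for i
  proof (rule pair_measure_eqI[symmetric])
    show "sigma_finite_measure (distr M borel (R0 i))"
      by (intro prob_space_imp_sigma_finite prob_space_distr R0 i)
    show "sigma_finite_measure (distr M ?TS (T i))"
      by (intro prob_space_imp_sigma_finite prob_space_distr T_meas i)
    show "sets (distr M borel (R0 i) \<Otimes>\<^sub>M distr M ?TS (T i)) = sets (distr M branch_space (?W i))"
      by (simp add: branch_space_def cong: sets_pair_measure_cong)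
    fix A A' assume "A \<in> sets (distr M borel (R0 i))" "A' \<in> sets (distr M ?TS (T i))"
    then have A: "A \<in> sets borel" "A' \<in> sets ?TS" by (simp_all only: sets_distr)
    then have AA: "A \<times> A' \<in> sets branch_space"
      unfolding branch_space_def by (rule pair_measureI)
    have "emeasure (distr M branch_space (?W i)) (A \<times> A') = emeasure M (?W i -` (A \<times> A') \<inter> space M)"
      by (rule emeasure_distr[OF W_meas[OF i] AA])
    also have "?W i -` (A \<times> A') \<inter> space M = (R0 i -` A \<inter> space M) \<inter> (T i -` A' \<inter> space M)"
      by (auto simp: W)
    also have "emeasure M \<dots> = emeasure M (R0 i -` A \<inter> space M) * emeasure M (T i -` A' \<inter> space M)"
      using indep_setD[OF indep_init in_AR[OF i A(1)] in_AV[OF i A(2)]]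
      by (simp only: emeasure_eq_measure ennreal_mult[OF measure_nonneg measure_nonneg])
    also have "emeasure M (R0 i -` A \<inter> space M) = emeasure (distr M borel (R0 i)) A"
      by (rule emeasure_distr[OF R0[OF i] A(1), symmetric])
    also have "emeasure M (T i -` A' \<inter> space M) = emeasure (distr M ?TS (T i)) A'"
      by (rule emeasure_distr[OF T_meas[OF i] A(2), symmetric])
    finally show "emeasure (distr M borel (R0 i)) A * emeasure (distr M ?TS (T i)) A'
        = emeasure (distr M branch_space (?W i)) (A \<times> A')" ..
  qed
  have T_law: "distr M ?TS (T i) = distr M ?TS (T j)" if "i \<in> tree_index" "j \<in> tree_index" for i j
  proof -
    have "distr M ?TS (T k) = distr branch_law ?TS snd" if "k \<in> tree_index" for k
    proof -
      have "snd \<in> measurable branch_space ?TS"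
        by (simp add: branch_space_def)
      from distr_distr[OF this measurable_branch[OF that]] show ?thesis
        unfolding distr_branch[OF that] by (simp only: T_def[abs_def] o_def)
    qed
    then show ?thesis using that by (simp only:)
  qed
  show "iid_vars M branch_space ?W tree_index"
    unfolding iid_vars_def
  proof (intro conjI ballI W_indep)
    fix i j assume i: "i \<in> tree_index" and j: "j \<in> tree_index"
    show "distr M branch_space (?W i) = distr M branch_space (?W j)"
      unfolding W_law[OF i] W_law[OF j] R0_law[OF i j] T_law[OF i j] ..
  qed
qed

section \<open>Convergence of the iterates\<close>

text \<open>Continuous step functions detect weak convergence, and their integrals converge by dominated
  convergence.\<close>

lemma weak_conv_m_distr_AE:
  fixes X :: "nat \<Rightarrow> 'a \<Rightarrow> real"
  assumes "prob_space M" and X [measurable]: "\<And>n. X n \<in> borel_measurable M"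
    and Y [measurable]: "Y \<in> borel_measurable M"
    and conv: "AE \<omega> in M. (\<lambda>n. X n \<omega>) \<longlonglongrightarrow> Y \<omega>"
  shows "weak_conv_m (\<lambda>n. distr M borel (X n)) (distr M borel Y)"
proof -
  interpret prob_space M by fact
  show ?thesis
  proof (rule integral_cts_step_conv_imp_weak_conv)
    show "real_distribution (distr M borel (X n))" for n
      by (rule real_distribution_distr) (rule X)
    show "real_distribution (distr M borel Y)"
      by (rule real_distribution_distr) (rule Y)
    fix x y :: real assume xy: "x < y"
    have cont: "continuous_on UNIV (cts_step x y)"
      by (intro uniformly_continuous_imp_continuous cts_step_uniformly_continuous xy)
    then have [measurable]: "cts_step x y \<in> borel_measurable borel"
      by (rule borel_measurable_continuous_onI)
    have "(\<lambda>n. \<integral>\<omega>. cts_step x y (X n \<omega>) \<partial>M) \<longlonglongrightarrow> (\<integral>\<omega>. cts_step x y (Y \<omega>) \<partial>M)"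
    proof (rule integral_dominated_convergence[where w = "\<lambda>_. 1"])
      show "AE \<omega> in M. (\<lambda>n. cts_step x y (X n \<omega>)) \<longlonglongrightarrow> cts_step x y (Y \<omega>)"
        using conv
      proof eventually_elim
        case (elim \<omega>)
        have "isCont (cts_step x y) (Y \<omega>)"
          using cont by (simp add: continuous_on_eq_continuous_at)
        then show ?case using elim by (rule isCont_tendsto_compose)
      qed
      show "AE \<omega> in M. norm (cts_step x y (X n \<omega>)) \<le> 1" for n
        using xy by (auto simp: cts_step_def divide_simps)
    qed auto
    then show "(\<lambda>n. integral\<^sup>L (distr M borel (X n)) (cts_step x y))
        \<longlonglongrightarrow> integral\<^sup>L (distr M borel Y) (cts_step x y)"
      by (simp add: integral_distr)
  qed
qed

theorem lemma4p5:
  fixes M :: "'a measure"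
    and Q :: "nat list \<Rightarrow> 'a \<Rightarrow> real"
    and N :: "nat list \<Rightarrow> 'a \<Rightarrow> enat"
    and C :: "nat list \<Rightarrow> 'a \<Rightarrow> real"
    and R0 :: "nat list \<Rightarrow> 'a \<Rightarrow> real"
    and \<beta> :: real
  assumes "weighted_branching_tree_init M Q N C R0"
    and "AE \<omega> in M. 0 \<le> Q [] \<omega> \<and> (\<forall>j\<ge>1. 0 \<le> C [j] \<omega>)"
    and "measure M {\<omega> \<in> space M. 0 < Q [] \<omega>} > 0"
    and "AE \<omega> in M. 0 \<le> R0 [] \<omega>"
    and "0 < \<beta>" and "\<beta> \<le> 1"
    and "(\<integral>\<^sup>+\<omega>. ennreal (Q [] \<omega> powr \<beta>) \<partial>M) < \<infinity>"
    and "(\<integral>\<^sup>+\<omega>. ennreal (R0 [] \<omega> powr \<beta>) \<partial>M) < \<infinity>"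
    and "(\<integral>\<^sup>+\<omega>. (\<Sum>\<^sub>\<infinity>i\<in>children (N [] \<omega>). ennreal (C [i] \<omega> powr \<beta>)) \<partial>M) < 1"
  shows "(\<forall>n. AE \<omega> in M. tree_iterate Q N C R0 n \<omega> < \<infinity>)
    \<and> (AE \<omega> in M. tree_total Q N C \<omega> < \<infinity>)
    \<and> weak_conv_m (\<lambda>n. real_law M (tree_iterate Q N C R0 n)) (real_law M (tree_total Q N C))
    \<and> (\<integral>\<^sup>+\<omega>. ennreal (enn2real (tree_total Q N C \<omega>) powr \<beta>) \<partial>M) < \<infinity>
    \<and> recursion_solution (distr M branch_space (branch_vector Q N C []))
         (real_law M (tree_total Q N C))
    \<and> (\<forall>\<mu>. recursion_solution (distr M branch_space (branch_vector Q N C [])) \<mu>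
         \<and> (\<integral>\<^sup>+x. ennreal (x powr \<beta>) \<partial>\<mu>) < \<infinity>
         \<longrightarrow> \<mu> = real_law M (tree_total Q N C))"
proof -
  interpret tree: contracting_branching_tree M Q N C \<beta>
    by (intro contracting_branching_tree.intro contracting_branching_tree_axioms.intro
        weighted_branching_tree_init.axioms(1)[OF assms(1)] assms)
  have "AE \<omega> in M. 0 \<le> R0 [] \<omega> \<and> (\<forall>j\<ge>1. 0 \<le> C [j] \<omega>)"
    using assms(2,4) by eventually_elim blast
  then interpret init_tree: contracting_branching_tree M R0 N C \<beta>
    by (intro contracting_branching_tree.intro contracting_branching_tree_axioms.intro
        weighted_branching_tree_init.tree_of_initial_values[OF assms(1)] assms)
  interpret recursion: contracting_recursion tree.branch_law \<beta>
    by (intro contracting_recursion.intro tree.prob_space_branch_law tree.sets_branch_law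
        tree.branch_law_nonneg tree.factor_moment assms)
  have sum_Q [measurable]: "tree_sum N C Q n \<in> borel_measurable M" for n
    by (rule measurable_tree_sum) (rule tree.measurable_branch)
  have sum_R0 [measurable]: "tree_sum N C R0 n \<in> borel_measurable M" for n
    by (rule measurable_tree_sum) (rule init_tree.measurable_branch)
  have iterate [measurable]: "tree_iterate Q N C R0 n \<in> borel_measurable M" for n
    unfolding tree_iterate_def[abs_def] by measurable
  note [measurable] = tree.measurable_tree_total
  have finite: "AE \<omega> in M. tree_iterate Q N C R0 n \<omega> < \<infinity>" for n
    using tree.tree_sum_finite init_tree.tree_sum_finite
    by eventually_elim (simp add: tree_iterate_def)
  have "AE \<omega> in M. (\<lambda>n. enn2real (tree_iterate Q N C R0 n \<omega>)) \<longlonglongrightarrow> enn2real (tree_total Q N C \<omega>)"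
    using tree.tree_total_finite init_tree.tree_sum_tendsto_0
  proof eventually_elim
    case (elim \<omega>)
    have "(\<lambda>n. \<Sum>k<n. tree_sum N C Q k \<omega>) \<longlonglongrightarrow> tree_total Q N C \<omega>"
      unfolding tree_total_def by (rule summable_LIMSEQ) simp
    then have "(\<lambda>n. tree_iterate Q N C R0 n \<omega>) \<longlonglongrightarrow> tree_total Q N C \<omega> + 0"
      unfolding tree_iterate_def by (rule tendsto_add) (rule elim)
    then show ?case
      using elim by (intro tendsto_enn2real) (simp_all add: less_top)
  qed
  then have weak: "weak_conv_m (\<lambda>n. real_law M (tree_iterate Q N C R0 n)) (real_law M (tree_total Q N C))"
    unfolding real_law_def
    by (intro weak_conv_m_distr_AE tree.prob_space_axioms) measurable
  have law_moment: "(\<integral>\<^sup>+x. ennreal (x powr \<beta>) \<partial>real_law M (tree_total Q N C)) < \<infinity>"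
    using tree.tree_total_moment unfolding real_law_def by (subst nn_integral_distr) measurable
  show ?thesis
    using finite tree.tree_total_finite weak tree.tree_total_moment tree.tree_total_solves_recursion
      recursion.solution_unique[OF _ _ _ law_moment, unfolded tree.branch_law_def]
    by blast
qed

end
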